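(* Let $n\ge1$ and let $m$ be a positive integer or half-integer. Let $\eta,\lambda$ be vectors, both of integers or both of half-integers, in $\mathcal A^{\tilde D_n}_m=\{(x_1,\dots,x_n): x_1>\dots>x_{n-1}>|x_n|,\ x_1+x_2<2m\}$. Then, as $k\to\infty$ with $k\equiv2\eta_j+2\lambda_j\pmod2$, the number of walks from $\eta$ to $\lambda$ with exactly $k$ diagonal steps staying in $\mathcal A^{\tilde D_n}_m$ is asymptotically $$\frac{4^{n^2}}{2(8m)^n}\left(2^n\prod_{j=0}^{n-1}\cos\frac{j\pi}{2m}\right)^k\prod_{1\le h<t\le n}\left(\sin\frac{\pi(\eta_h-\eta_t)}{2m}\sin\frac{\pi(\lambda_h-\lambda_t)}{2m}\sin\frac{\pi(\eta_h+\eta_t)}{2m}\sin\frac{\pi(\lambda_h+\lambda_t)}{2m}\right).$$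
   Context: A half-integer is an odd integer divided by $2$. A walk with $k$ diagonal steps from $\eta$ to $\lambda$ is a sequence $p_0=\eta,\dots,p_k=\lambda$ with $p_i-p_{i-1}\in\{(\pm\frac12,\dots,\pm\frac12)\}$ (all sign patterns); it stays in $R$ if all $p_i\in R$. "Asymptotically $E$" means the ratio of the count to $E$ tends to $1$.
   Formalization: The case n=1 is excluded (the set mentions x_2 and the claim fails), and for n=2 the alcove also requires x_1−x_2<2m, since the printed set is unbounded and the claim is false there (e.g. m=1). *)

theory Defs
  imports "HOL-Analysis.Analysis" "HOL-Library.Landau_Symbols" "HOL-Library.Real_Mod"
begin

definition half_integer :: "real \<Rightarrow> bool" where
  "half_integer x \<longleftrightarrow> (\<exists>a::int. odd a \<and> x = of_int a / 2)"

text \<open>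
  A vector of length \<open>n \<ge> 2\<close> is an extensional function on \<open>{1..n}\<close>, so that each vector is
  represented once.

  The last conjunct is needed only for the reducible root system \<open>D\<^sub>2\<close>: both of its orthogonal positive
  roots \<open>x\<^sub>1 - x\<^sub>2\<close> and \<open>x\<^sub>1 + x\<^sub>2\<close> contribute an affine wall, and without the one for \<open>x\<^sub>1 - x\<^sub>2\<close> the set
  would be unbounded. For \<open>n \<ge> 3\<close> the inequality \<open>x\<^sub>1 - x\<^sub>2 < 2m\<close> follows from the other conditions.
\<close>
definition alcove_D :: "nat \<Rightarrow> real \<Rightarrow> (nat \<Rightarrow> real) set" where
  "alcove_D n m = {x \<in> extensional {1..n}.
     (\<forall>i. 1 \<le> i \<and> i + 1 \<le> n - 1 \<longrightarrow> x i > x (i + 1)) \<and>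
     x (n - 1) > \<bar>x n\<bar> \<and>
     x 1 + x 2 < 2 * m \<and>
     (n = 2 \<longrightarrow> x 1 - x 2 < 2 * m)}"

lemma alcove_D_ge3:
  assumes "n \<ge> 3"
  shows "alcove_D n m = {x \<in> extensional {1..n}.
     (\<forall>i. 1 \<le> i \<and> i + 1 \<le> n - 1 \<longrightarrow> x i > x (i + 1)) \<and>
     x (n - 1) > \<bar>x n\<bar> \<and> x 1 + x 2 < 2 * m}"
  using assms unfolding alcove_D_def by auto

definition diagonal_walks ::
  "nat \<Rightarrow> (nat \<Rightarrow> real) set \<Rightarrow> nat \<Rightarrow> (nat \<Rightarrow> real) \<Rightarrow> (nat \<Rightarrow> real) \<Rightarrow> (nat \<Rightarrow> nat \<Rightarrow> real) set" where
  "diagonal_walks n R k \<eta> \<mu> = {p \<in> {0..k} \<rightarrow>\<^sub>E R.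
     p 0 = \<eta> \<and> p k = \<mu> \<and>
     (\<forall>i\<in>{1..k}. \<forall>j\<in>{1..n}. p i j - p (i - 1) j \<in> {1/2, -1/2})}"

end

theory Submission
  imports Defs "Jordan_Normal_Form.Determinant"
begin

text \<open>
  A diagonal step moves all coordinates independently, and from a point of the alcove it ends in the
  alcove or on one of its walls. So the number of walks is the unique solution of the step recursion
  that vanishes on the walls and starts as a delta function. Such a solution is the mean of four
  determinants of one-dimensional kernels, one for each choice of the symmetry (even or odd) at the two
  fixed points \<open>0\<close> and \<open>m\<close> of the affine reflections; averaging over the four choices implements the
  parity constraints in the affine Weyl group of type \<open>D\<close>.

  Each kernel is diagonalised by cosine or sine waves. For even \<open>k\<close> the frequencies \<open>\<nu>\<close> and
  \<open>2 m - \<nu>\<close> contribute equally, hence only frequencies in \<open>[0, m]\<close> remain, where the eigenvalues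
  \<open>2 cos (\<pi> \<nu> / (2 m))\<close> decrease. By Cauchy--Binet only sets of \<open>n\<close> distinct frequencies occur, so the
  set \<open>{0, \<dots>, n - 1}\<close> dominates. It belongs to the kernel that is even at both ends, and its coefficient
  is a product of two Chebyshev--Vandermonde determinants.
\<close>

section \<open>Determinants\<close>

definition fdet :: "nat \<Rightarrow> (nat \<Rightarrow> nat \<Rightarrow> real) \<Rightarrow> real" where
  "fdet n A = det (mat n n (\<lambda>(i, j). A i j))"

lemma fdet_Leibniz:
  "fdet n A = (\<Sum>p | p permutes {0..<n}. signof p * (\<Prod>i=0..<n. A i (p i)))"
  unfolding fdet_def
  by (subst det_def'[of _ n], simp, intro sum.cong refl)
     (auto intro!: prod.cong dest!: permutes_in_image)

lemma fdet_cong: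
  assumes "\<And>i j. i < n \<Longrightarrow> j < n \<Longrightarrow> A i j = B i j"
  shows "fdet n A = fdet n B"
  unfolding fdet_def by (rule arg_cong[of _ _ det]) (auto intro!: eq_matI simp: assms)

text \<open>Pulling the factor out of one column leaves two equal columns. This makes the
  determinants vanish on the walls.\<close>

lemma fdet_proportional_columns:
  assumes "h < n" "t < n" "h \<noteq> t" and pr: "\<And>i. i < n \<Longrightarrow> A i h = c * A i t"
  shows "fdet n A = 0"
proof -
  define B where "B = mat n n (\<lambda>(i, j). A i (if j = h then t else j))"
  have B: "B \<in> carrier_mat n n" by (simp add: B_def)
  have "det B = 0"
    by (rule det_identical_columns[OF B assms(3,1,2)])
       (use assms in \<open>auto simp: B_def intro!: eq_vecI\<close>)
  \<comment> \<open>The scaling rule is for rows, hence the transpose.\<close>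
  have "fdet n A = det (multrow h c (transpose_mat B))"
    unfolding fdet_def
    by (subst det_transpose[symmetric, of _ n])
       (use assms in \<open>auto simp: B_def intro!: arg_cong[of _ _ det] eq_matI\<close>)
  also have "\<dots> = c * det B"
    using det_multrow[OF assms(1), of "transpose_mat B" c] det_transpose[OF B] B by simp
  finally show ?thesis using \<open>det B = 0\<close> by simp
qed

text \<open>Only the identity contributes to the Leibniz sum. This serves walks of length 0, where
  nonzero entries force the permutation to preserve the order.\<close>

lemma fdet_diagonal:
  assumes "\<And>p. p permutes {0..<n} \<Longrightarrow> (\<And>i. i < n \<Longrightarrow> A i (p i) \<noteq> 0) \<Longrightarrow> p = id"
  shows "fdet n A = (\<Prod>i=0..<n. A i i)"
proof -
  have "fdet n A = (\<Sum>p\<in>{id}. signof p * (\<Prod>i=0..<n. A i (p i)))"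
    unfolding fdet_Leibniz
  proof (rule sum.mono_neutral_right)
    show "\<forall>p\<in>{p. p permutes {0..<n}} - {id}. signof p * (\<Prod>i=0..<n. A i (p i)) = 0"
      using assms by (force simp: prod_zero_iff)
  qed (auto simp: permutes_id finite_permutations)
  thus ?thesis by simp
qed

text \<open>Cauchy--Binet before collecting equal index sets.\<close>
lemma fdet_sum_expand:
  fixes c :: "nat \<Rightarrow> real" and f g :: "nat \<Rightarrow> nat \<Rightarrow> real"
  assumes "finite S"
  shows "fdet n (\<lambda>i j. \<Sum>d\<in>S. c d * f d i * g d j) =
    (\<Sum>d\<in>{0..<n} \<rightarrow>\<^sub>E S. (\<Prod>i=0..<n. c (d i)) * (\<Prod>i=0..<n. f (d i) i) * fdet n (\<lambda>i j. g (d i) j))"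
proof -
  have "fdet n (\<lambda>i j. \<Sum>d\<in>S. c d * f d i * g d j) =
     (\<Sum>p | p permutes {0..<n}. \<Sum>d\<in>{0..<n} \<rightarrow>\<^sub>E S.
        signof p * (\<Prod>i=0..<n. c (d i) * f (d i) i * g (d i) (p i)))"
    unfolding fdet_Leibniz using assms
    by (subst prod_sum_PiE) (auto simp: sum_distrib_left)
  also have "\<dots> = (\<Sum>d\<in>{0..<n} \<rightarrow>\<^sub>E S. \<Sum>p | p permutes {0..<n}.
        signof p * (\<Prod>i=0..<n. c (d i) * f (d i) i * g (d i) (p i)))"
    by (rule sum.swap)
  also have "\<dots> = (\<Sum>d\<in>{0..<n} \<rightarrow>\<^sub>E S. (\<Prod>i=0..<n. c (d i)) * (\<Prod>i=0..<n. f (d i) i) * fdet n (\<lambda>i j. g (d i) j))"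
    unfolding fdet_Leibniz by (simp add: sum_distrib_left prod.distrib mult_ac)
  finally show ?thesis .
qed

lemma fdet_equal_rows:
  assumes "i < n" "i' < n" "i \<noteq> i'" "\<And>j. j < n \<Longrightarrow> A i j = A i' j"
  shows "fdet n A = 0"
  unfolding fdet_def
  by (rule det_identical_rows[where i = i and j = i'])
     (use assms in \<open>auto intro!: eq_vecI\<close>)

lemma fdet_permute_rows:
  assumes "p permutes {0..<n}"
  shows "fdet n (\<lambda>i. A (p i)) = signof p * fdet n A"
  unfolding fdet_def
  by (subst det_permute_rows[OF _ assms, symmetric])
     (use assms in \<open>auto intro!: arg_cong[of _ _ det] eq_matI dest: permutes_in_image\<close>)

text \<open>Multilinearity in the columns. It reduces the sum over all sign patterns of a diagonal
  step to separate half-steps in each coordinate.\<close>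

lemma fdet_column_sums:
  assumes "finite E"
  shows "(\<Sum>e\<in>{0..<n} \<rightarrow>\<^sub>E E. fdet n (\<lambda>i j. A i j (e j))) = fdet n (\<lambda>i j. \<Sum>s\<in>E. A i j s)"
proof -
  \<comment> \<open>The Leibniz product runs over rows while \<open>e\<close> chooses per column, so
    the product is reindexed by the inverse permutation.\<close>
  have *: "(\<Prod>i=0..<n. B i (p i)) = (\<Prod>j=0..<n. B (Hilbert_Choice.inv p j) j)" if "p permutes {0..<n}"
    for B :: "nat \<Rightarrow> nat \<Rightarrow> real" and p
    using prod.permute[OF that, of "\<lambda>j. B (Hilbert_Choice.inv p j) j"] permutes_inverses(2)[OF that] by (simp add: o_def)
  have "fdet n (\<lambda>i j. \<Sum>s\<in>E. A i j s) = (\<Sum>p | p permutes {0..<n}. \<Sum>e\<in>{0..<n} \<rightarrow>\<^sub>E E.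
      signof p * (\<Prod>j=0..<n. A (Hilbert_Choice.inv p j) j (e j)))"
    unfolding fdet_Leibniz using assms
    by (intro sum.cong refl, subst *) (auto simp: prod_sum_PiE sum_distrib_left)
  also have "\<dots> = (\<Sum>e\<in>{0..<n} \<rightarrow>\<^sub>E E. \<Sum>p | p permutes {0..<n}.
      signof p * (\<Prod>j=0..<n. A (Hilbert_Choice.inv p j) j (e j)))"
    by (rule sum.swap)
  also have "\<dots> = (\<Sum>e\<in>{0..<n} \<rightarrow>\<^sub>E E. fdet n (\<lambda>i j. A i j (e j)))"
    unfolding fdet_Leibniz by (intro sum.cong refl, subst *) auto
  finally show ?thesis ..
qed

section \<open>One-dimensional reflected kernels\<close>

text \<open>
  Here and below \<open>N = 2 m\<close>. A phase \<open>\<tau> \<in> {0, \<pi>/2}\<close> makes the waves even or odd, and an offset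
  \<open>\<delta> \<in> {0, 1/2}\<close> of the frequencies makes them periodic or antiperiodic under translation by \<open>N\<close>.
\<close>
definition wave :: "nat \<Rightarrow> real \<Rightarrow> real \<Rightarrow> real \<Rightarrow> real" where
  "wave N \<tau> z x = cos (2 * pi * z * x / real N - \<tau>)"

text \<open>The factor \<open>2 / real N\<close> makes the kernel for \<open>k = 0\<close> a signed
  sum of delta functions at the images of \<open>a\<close> under translation by \<open>N\<close> and
  reflection.\<close>

definition refl_kernel :: "nat \<Rightarrow> real \<Rightarrow> real \<Rightarrow> nat \<Rightarrow> real \<Rightarrow> real \<Rightarrow> real" where
  "refl_kernel N \<delta> \<tau> k a b = 2 / real N *
     (\<Sum>\<nu><N. (2 * cos (pi * (real \<nu> + \<delta>) / real N)) ^ k * wave N \<tau> (real \<nu> + \<delta>) a * wave N \<tau> (real \<nu> + \<delta>) b)"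

text \<open>By the addition theorem, waves of any phase are eigenfunctions of the half-step
  operator. This gives the kernel its recursion in \<open>k\<close>.\<close>

lemma wave_step:
  assumes "N > 0"
  shows "wave N \<tau> z (x + 1/2) + wave N \<tau> z (x - 1/2) = 2 * cos (pi * z / real N) * wave N \<tau> z x"
proof -
  have "2 * pi * z * (x + 1/2) / real N - \<tau> = (2 * pi * z * x / real N - \<tau>) + pi * z / real N"
       "2 * pi * z * (x - 1/2) / real N - \<tau> = (2 * pi * z * x / real N - \<tau>) - pi * z / real N"
    using assms by (simp_all add: field_simps)
  thus ?thesis unfolding wave_def by (simp only: cos_add cos_diff) (simp add: algebra_simps)
qed

lemma refl_kernel_Suc:
  assumes "N > 0"
  shows "refl_kernel N \<delta> \<tau> (Suc k) a b = refl_kernel N \<delta> \<tau> k a (b + 1/2) + refl_kernel N \<delta> \<tau> k a (b - 1/2)"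
proof -
  let ?z = "\<lambda>\<nu>. real \<nu> + \<delta>"
  let ?l = "\<lambda>\<nu>. 2 * cos (pi * ?z \<nu> / real N)"
  have "refl_kernel N \<delta> \<tau> k a (b + 1/2) + refl_kernel N \<delta> \<tau> k a (b - 1/2) =
     2 / real N * (\<Sum>\<nu><N. ?l \<nu> ^ k * wave N \<tau> (?z \<nu>) a * (wave N \<tau> (?z \<nu>) (b + 1/2) + wave N \<tau> (?z \<nu>) (b - 1/2)))"
    unfolding refl_kernel_def by (simp only: distrib_left sum.distrib)
  also have "\<dots> = refl_kernel N \<delta> \<tau> (Suc k) a b"
    unfolding refl_kernel_def wave_step[OF assms] by (simp add: mult_ac)
  finally show ?thesis ..
qed

text \<open>For the two phases \<open>cos (2 * \<tau>)\<close> is just a sign: 1 for cosine waves,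
  -1 for sine waves.\<close>

lemma wave_minus:
  assumes "\<tau> \<in> {0, pi/2}"
  shows "wave N \<tau> z (- x) = cos (2 * \<tau>) * wave N \<tau> z x" "wave N \<tau> (- z) x = cos (2 * \<tau>) * wave N \<tau> z x"
  using assms unfolding wave_def insert_iff empty_iff
  by (safe; simp add: cos_diff cos_add)+

text \<open>The translation adds \<open>2 * pi * \<delta>\<close> to the angle, up to full turns.
  For the two offsets \<open>cos (2 * pi * \<delta>)\<close> is again a sign, 1 or -1.\<close>

lemma wave_period:
  assumes "N > 0" "\<delta> \<in> {0, 1/2}"
  shows "wave N \<tau> (real \<nu> + \<delta>) (x + real N) = cos (2 * pi * \<delta>) * wave N \<tau> (real \<nu> + \<delta>) x"
proof -
  let ?y = "2 * pi * (real \<nu> + \<delta>) * x / real N - \<tau>"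
  have "2 * pi * (real \<nu> + \<delta>) * (x + real N) / real N - \<tau> = ?y + 2 * pi * \<delta> + 2 * pi * real_of_int (int \<nu>)"
    using assms(1) by (simp add: field_simps)
  hence "wave N \<tau> (real \<nu> + \<delta>) (x + real N) = cos (?y + 2 * pi * \<delta>)"
    unfolding wave_def by (simp only: cos_add[of _ "2 * pi * real_of_int _"] cos_int_2pin sin_int_2pin mult_1_right mult_zero_right diff_zero)
  also have "\<dots> = cos (2 * pi * \<delta>) * cos ?y"
    using assms(2) unfolding insert_iff empty_iff by (safe; simp add: cos_add)
  finally show ?thesis unfolding wave_def .
qed

lemma refl_kernel_minus:
  assumes "\<tau> \<in> {0, pi/2}"
  shows "refl_kernel N \<delta> \<tau> k a (- b) = cos (2 * \<tau>) * refl_kernel N \<delta> \<tau> k a b"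
  unfolding refl_kernel_def wave_minus(1)[OF assms] by (simp add: sum_distrib_left mult_ac)

lemma refl_kernel_period:
  assumes "N > 0" "\<delta> \<in> {0, 1/2}"
  shows "refl_kernel N \<delta> \<tau> k a (b + real N) = cos (2 * pi * \<delta>) * refl_kernel N \<delta> \<tau> k a b"
  unfolding refl_kernel_def wave_period[OF assms] by (simp add: sum_distrib_left mult_ac)

text \<open>The sum is the real part of a geometric sum over powers of an \<open>N\<close>-th root
  of unity, times a constant phase coming from the offset.\<close>

lemma sum_cos_roots:
  assumes "N > 0"
  shows "(\<Sum>\<nu><N. cos (2 * pi * (real \<nu> + \<delta>) * real_of_int c / real N)) =
    (if int N dvd c then real N * cos (2 * pi * \<delta> * real_of_int c / real N) else 0)"
proof (cases "int N dvd c")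
  case True
  then obtain r where r: "c = int N * r" by auto
  have "cos (2 * pi * (real \<nu> + \<delta>) * real_of_int c / real N) = cos (2 * pi * \<delta> * real_of_int c / real N)" for \<nu>
  proof -
    have "2 * pi * (real \<nu> + \<delta>) * real_of_int c / real N =
       2 * pi * \<delta> * real_of_int c / real N + 2 * pi * real_of_int (int \<nu> * r)"
      using assms by (simp add: r field_simps)
    thus ?thesis by (simp only: cos_add cos_int_2pin sin_int_2pin)
  qed
  thus ?thesis using True by simp
next
  case False
  define w where "w = cis (2 * pi * real_of_int c / real N)"
  have "w ^ N = 1"
  proof -
    have "real N * (2 * pi * real_of_int c / real N) = 2 * pi * real_of_int c" using assms by simp
    thus ?thesis unfolding w_def Complex.DeMoivre by (simp only:) simp
  qed
  have "w \<noteq> 1"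
  proof
    assume "w = 1"
    hence "cos (2 * pi * real_of_int c / real N) = 1" by (simp add: w_def complex_eq_iff)
    then obtain r :: int where "2 * pi * real_of_int c / real N = of_int r * 2 * pi"
      using cos_one_2pi_int by blast
    hence "real_of_int c = real N * of_int r" using assms by (simp add: field_simps)
    hence "c = int N * r" by (metis of_int_eq_iff of_int_mult of_int_of_nat_eq)
    thus False using False by simp
  qed
  have "(\<Sum>\<nu><N. w ^ \<nu>) = 0" using \<open>w ^ N = 1\<close> \<open>w \<noteq> 1\<close> by (simp add: sum_gp_strict)
  have "(\<Sum>\<nu><N. cis (2 * pi * (real \<nu> + \<delta>) * real_of_int c / real N)) =
     cis (2 * pi * \<delta> * real_of_int c / real N) * (\<Sum>\<nu><N. w ^ \<nu>)"
    using assms by (simp add: sum_distrib_left w_def Complex.DeMoivre cis_mult algebra_simps add_divide_distrib)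
  hence "(\<Sum>\<nu><N. cis (2 * pi * (real \<nu> + \<delta>) * real_of_int c / real N)) = 0"
    using \<open>(\<Sum>\<nu><N. w ^ \<nu>) = 0\<close> by simp
  hence "Re (\<Sum>\<nu><N. cis (2 * pi * (real \<nu> + \<delta>) * real_of_int c / real N)) = 0" by simp
  thus ?thesis using False by simp
qed

text \<open>The product of two waves splits into cosines of the difference and of the sum, and each
  is summed over roots of unity. The first term is a periodised delta function, the second its
  signed mirror image.\<close>

lemma refl_kernel_0:
  assumes "N > 0" "\<tau> \<in> {0, pi/2}" "a - b = real_of_int c" "a + b = real_of_int d"
  shows "refl_kernel N \<delta> \<tau> 0 a b =
     (if int N dvd c then cos (2 * pi * \<delta> * real_of_int c / real N) else 0) +
     cos (2 * \<tau>) * (if int N dvd d then cos (2 * pi * \<delta> * real_of_int d / real N) else 0)"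
proof -
  have prod: "2 * (wave N \<tau> z a * wave N \<tau> z b) =
     cos (2 * pi * z * real_of_int c / real N) + cos (2 * \<tau>) * cos (2 * pi * z * real_of_int d / real N)" for z
  proof -
    let ?A = "2 * pi * z * a / real N" and ?B = "2 * pi * z * b / real N"
    have "2 * pi * z * real_of_int c / real N = ?A - ?B" "2 * pi * z * real_of_int d / real N = ?A + ?B"
      by (simp_all add: assms(3,4)[symmetric] algebra_simps add_divide_distrib diff_divide_distrib)
    moreover have "2 * (cos (?A - \<tau>) * cos (?B - \<tau>)) = cos (?A - ?B) + cos (2 * \<tau>) * cos (?A + ?B)"
      using assms(2) unfolding insert_iff empty_iff by (safe; simp add: cos_add cos_diff)
    ultimately show ?thesis unfolding wave_def by simp
  qed
  have "refl_kernel N \<delta> \<tau> 0 a b = 1 / real N * (\<Sum>\<nu><N. 2 * (wave N \<tau> (real \<nu> + \<delta>) a * wave N \<tau> (real \<nu> + \<delta>) b))"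
    unfolding refl_kernel_def by (simp add: sum_distrib_left)
  also have "\<dots> = 1 / real N * ((\<Sum>\<nu><N. cos (2 * pi * (real \<nu> + \<delta>) * real_of_int c / real N)) +
      cos (2 * \<tau>) * (\<Sum>\<nu><N. cos (2 * pi * (real \<nu> + \<delta>) * real_of_int d / real N)))"
    unfolding prod by (simp add: sum.distrib sum_distrib_left)
  finally show ?thesis
    unfolding sum_cos_roots[OF assms(1)] using assms(1) by (auto simp: distrib_left)
qed

section \<open>The alcove and its walls\<close>

text \<open>The right-hand side bounds all positive roots \<open>x h - x t\<close> and
  \<open>x h + x t\<close>, so that leaving the alcove can be blamed on a single pair of
  coordinates.\<close>

lemma alcove_D_iff:
  assumes "n \<ge> 2"
  shows "x \<in> alcove_D n m \<longleftrightarrow> x \<in> extensional {1..n} \<and>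
    (\<forall>h t. 1 \<le> h \<and> h < t \<and> t \<le> n \<longrightarrow>
       0 < x h - x t \<and> x h - x t < 2 * m \<and> 0 < x h + x t \<and> x h + x t < 2 * m)" (is "_ \<longleftrightarrow> ?R")
proof
  assume x: "x \<in> alcove_D n m"
  have step: "x (i + 1) < x i" if "1 \<le> i" "i + 1 \<le> n - 1" for i
    using x that unfolding alcove_D_def by blast
  have last: "\<bar>x n\<bar> < x (n - 1)" and top: "x 1 + x 2 < 2 * m" and top2: "n = 2 \<Longrightarrow> x 1 - x 2 < 2 * m"
    using x unfolding alcove_D_def by auto
  have mono: "x t \<le> x h" if "1 \<le> h" "h \<le> t" "t \<le> n - 1" for h t
    using that(2,1,3)
  proof (induction t rule: dec_induct)
    case (step t)
    with \<open>\<And>i. 1 \<le> i \<Longrightarrow> i + 1 \<le> n - 1 \<Longrightarrow> x (i + 1) < x i\<close>[of t] show ?case by simp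
  qed simp
  have "0 < x h - x t \<and> x h - x t < 2 * m \<and> 0 < x h + x t \<and> x h + x t < 2 * m"
    if ht: "1 \<le> h" "h < t" "t \<le> n" for h t
  proof (cases "t = n")
    case True
    have "x (n - 1) \<le> x h" "x h \<le> x 1" using mono[of h "n - 1"] mono[of 1 h] ht True by auto
    \<comment> \<open>For \<open>n = 2\<close> the right side would be \<open>x n\<close> itself;
      that case rests on the separate bound for \<open>x 1 - x 2\<close>.\<close>
    moreover have "\<bar>x n\<bar> < x 2" if "n \<noteq> 2"
    proof -
      have "2 \<le> n - 1" using that assms by linarith
      thus ?thesis using mono[of 2 "n - 1"] last by simp
    qed
    moreover have "h = 1" if "n = 2" using ht True that by auto
    ultimately show ?thesis using last top top2 True by (cases "n = 2") (auto simp: abs_if split: if_splits)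
  next
    case False
    hence t: "t \<le> n - 1" using ht by auto
    have "x t < x h" using mono[of "h + 1" t] step[of h] ht t by auto
    moreover have "x (n - 1) \<le> x t" "x h \<le> x 1" "x t \<le> x 2"
      using mono[of t "n - 1"] mono[of 1 h] mono[of 2 t] ht t by auto
    ultimately show ?thesis using last top by auto
  qed
  thus ?R using x unfolding alcove_D_def by blast
next
  assume R: ?R
  hence *: "0 < x h - x t" "x h - x t < 2 * m" "0 < x h + x t" "x h + x t < 2 * m"
    if "1 \<le> h" "h < t" "t \<le> n" for h t
    using that by blast+
  have "1 \<le> n - 1" "n - 1 < n" using assms by linarith+
  hence "\<bar>x n\<bar> < x (n - 1)" using *[of "n - 1" n] by linarith
  moreover have "x (i + 1) < x i" if "1 \<le> i" "i + 1 \<le> n - 1" for i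
    using *[of i "i + 1"] that by auto
  ultimately show "x \<in> alcove_D n m"
    unfolding alcove_D_def using R *[of 1 2] assms by auto
qed

text \<open>Only the first coordinate can reach or pass \<open>m\<close>, and only the last can fail
  to be positive. Hence the reflection at \<open>m\<close> concerns the first coordinate alone and
  the reflection at 0 only the last.\<close>

lemma alcove_D_bounds:
  assumes "n \<ge> 2" "x \<in> alcove_D n m"
  shows "0 < x 1" "x 1 < 2 * m"
    "2 \<le> j \<Longrightarrow> j \<le> n \<Longrightarrow> \<bar>x j\<bar> < m" "2 \<le> j \<Longrightarrow> j < n \<Longrightarrow> 0 < x j"
proof -
  have *: "0 < x h - x t" "x h - x t < 2 * m" "0 < x h + x t" "x h + x t < 2 * m"
    if "1 \<le> h" "h < t" "t \<le> n" for h t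
    using assms that unfolding alcove_D_iff[OF assms(1)] by blast+
  show "0 < x 1" "x 1 < 2 * m" using *[of 1 2] assms by auto
  show "\<bar>x j\<bar> < m" if "2 \<le> j" "j \<le> n" using *[of 1 j] that by auto
  show "0 < x j" if "2 \<le> j" "j < n" using *[of j n] that by auto
qed

lemma sin_pi_times_pos:
  fixes m y :: real
  assumes "m > 0" "0 < y" "y < 2 * m"
  shows "0 < sin (pi * y / (2 * m))"
proof (rule sin_gt_zero)
  have "pi * (y / (2 * m)) < pi * 1" using assms by (intro mult_strict_left_mono) auto
  thus "pi * y / (2 * m) < pi" by simp
qed (use assms in simp)

text \<open>The two roots of a pair combine into one difference of cosines. This serves both the
  ordering of the coordinates and the final Vandermonde products.\<close>

lemma cos_diff_eq_sin_mult_sin: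
  fixes m x y :: real
  assumes "m > 0"
  shows "cos (pi * y / m) - cos (pi * x / m) = 2 * sin (pi * (x + y) / (2 * m)) * sin (pi * (x - y) / (2 * m))"
proof -
  have "(pi * y / m + pi * x / m) / 2 = pi * (x + y) / (2 * m)"
    "(pi * x / m - pi * y / m) / 2 = pi * (x - y) / (2 * m)"
    using assms by (simp_all add: field_simps)
  thus ?thesis by (simp only: cos_diff_cos)
qed

text \<open>The function \<open>cos (pi * y / m)\<close> of \<open>y\<close> is unchanged by sign
  change and by translation by \<open>2 * m\<close>, yet it still orders the coordinates of an
  alcove point.\<close>

lemma alcove_D_cos_strict_mono:
  assumes "n \<ge> 2" "x \<in> alcove_D n m" "m > 0" "1 \<le> h" "h < t" "t \<le> n"
  shows "cos (pi * x h / m) < cos (pi * x t / m)"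
proof -
  have *: "0 < x h - x t" "x h - x t < 2 * m" "0 < x h + x t" "x h + x t < 2 * m"
    using assms unfolding alcove_D_iff[OF assms(1)] by blast+
  have "0 < sin (pi * (x h - x t) / (2 * m))" "0 < sin (pi * (x h + x t) / (2 * m))"
    using * assms(3) by (auto intro!: sin_pi_times_pos)
  hence "0 < cos (pi * x t / m) - cos (pi * x h / m)"
    unfolding cos_diff_eq_sin_mult_sin[OF assms(3)] by simp
  thus ?thesis by simp
qed

text \<open>Matrix indices start at \<open>0\<close>, coordinates at \<open>1\<close>.\<close>
definition refl_det :: "nat \<Rightarrow> nat \<Rightarrow> nat \<Rightarrow> (nat \<Rightarrow> real) \<Rightarrow> (nat \<Rightarrow> real) \<Rightarrow> real" where
  "refl_det N k n \<eta> \<mu> = (\<Sum>\<delta>\<in>{0, 1/2}. \<Sum>\<tau>\<in>{0, pi/2}.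
     fdet n (\<lambda>i j. refl_kernel N \<delta> \<tau> k (\<eta> (Suc i)) (\<mu> (Suc j)))) / 4"

text \<open>Only the parity of \<open>c\<close> matters: even for integers, odd for half-integers.
  Allowing any integer lets each step add 1.\<close>

definition in_coset :: "nat \<Rightarrow> int \<Rightarrow> (nat \<Rightarrow> real) \<Rightarrow> bool" where
  "in_coset n c x \<longleftrightarrow> (\<forall>j\<in>{1..n}. x j - of_int c / 2 \<in> \<int>)"

lemma in_coset_diff: "in_coset n c x \<Longrightarrow> in_coset n c y \<Longrightarrow> i \<in> {1..n} \<Longrightarrow> j \<in> {1..n} \<Longrightarrow> x i - y j \<in> \<int>"
proof -
  assume "in_coset n c x" "in_coset n c y" "i \<in> {1..n}" "j \<in> {1..n}"
  hence "(x i - of_int c / 2) - (y j - of_int c / 2) \<in> \<int>"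
    unfolding in_coset_def by (blast intro: Ints_diff)
  thus ?thesis by simp
qed

lemma in_coset_add: "in_coset n c x \<Longrightarrow> in_coset n c y \<Longrightarrow> i \<in> {1..n} \<Longrightarrow> j \<in> {1..n} \<Longrightarrow> x i + y j \<in> \<int>"
proof -
  assume "in_coset n c x" "in_coset n c y" "i \<in> {1..n}" "j \<in> {1..n}"
  hence "(x i - of_int c / 2) + (y j - of_int c / 2) + of_int c \<in> \<int>"
    unfolding in_coset_def by (blast intro: Ints_add Ints_of_int)
  thus ?thesis by simp
qed

section \<open>Initial and boundary values of the determinants\<close>

text \<open>A nonzero value forces \<open>a\<close> and \<open>b\<close> to agree up to sign and
  multiples of \<open>N\<close>, which the cosine does not see.\<close>

lemma refl_kernel_0_nonzero:
  assumes "N > 0" "\<tau> \<in> {0, pi/2}" "a - b \<in> \<int>" "a + b \<in> \<int>" "refl_kernel N \<delta> \<tau> 0 a b \<noteq> 0"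
  shows "cos (2 * pi * a / real N) = cos (2 * pi * b / real N)"
proof -
  obtain c d where cd: "a - b = real_of_int c" "a + b = real_of_int d" using assms(3,4) by (auto elim!: Ints_cases)
  have "int N dvd c \<or> int N dvd d"
    using assms(5) refl_kernel_0[OF assms(1,2) cd, of \<delta>] by (auto split: if_splits)
  then obtain r where "c = int N * r \<or> d = int N * r" by auto
  hence "a = b + real N * of_int r \<or> a = - b + real N * of_int r"
    using cd by auto
  hence "2 * pi * a / real N = 2 * pi * b / real N + 2 * pi * real_of_int r \<or>
         2 * pi * a / real N = - (2 * pi * b / real N) + 2 * pi * real_of_int r"
  proof (elim disjE)
    have e: "2 * pi * (y + real N * of_int r) / real N = 2 * pi * y / real N + 2 * pi * of_int r" for y
      using assms(1) by (simp add: field_simps)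
    show ?thesis if "a = b + real N * of_int r" unfolding that e by simp
    show ?thesis if "a = - b + real N * of_int r" unfolding that e by simp
  qed
  thus ?thesis by (elim disjE) (simp_all only: cos_add cos_int_2pin sin_int_2pin cos_minus mult_1_right mult_zero_right diff_zero)
qed

text \<open>Under these bounds the only multiple of \<open>N\<close> available to
  \<open>a - b\<close> is 0 and to \<open>a + b\<close> is \<open>N\<close>; the latter is the
  mirror image at \<open>m\<close>.\<close>

lemma refl_kernel_0_first:
  assumes "N > 0" "\<tau> \<in> {0, pi/2}" "a - b \<in> \<int>" "a + b \<in> \<int>"
    "0 < a" "a < real N" "0 < b" "b < real N"
  shows "refl_kernel N \<delta> \<tau> 0 a b =
    of_bool (a = b) + cos (2 * \<tau>) * cos (2 * pi * \<delta>) * of_bool (a + b = real N)"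
proof -
  obtain c d where cd: "a - b = real_of_int c" "a + b = real_of_int d" using assms(3,4) by (auto elim!: Ints_cases)
  have c: "int N dvd c \<longleftrightarrow> c = 0"
  proof
    assume "int N dvd c"
    moreover have "\<bar>c\<bar> < int N" using cd assms by linarith
    ultimately show "c = 0" using zdvd_not_zless[of "\<bar>c\<bar>" "int N"] by force
  qed simp
  have d: "int N dvd d \<longleftrightarrow> d = int N"
  proof
    assume "int N dvd d"
    then obtain r where r: "d = int N * r" by auto
    moreover have "0 < d" "d < 2 * int N" using cd assms by linarith+
    ultimately have "0 < r" "r < 2" using assms(1) by (auto simp: zero_less_mult_iff)
    thus "d = int N" using r by simp
  qed simp
  have "a = b \<longleftrightarrow> c = 0" "a + b = real N \<longleftrightarrow> d = int N" using cd by linarith+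
  thus ?thesis unfolding refl_kernel_0[OF assms(1,2) cd] c d using assms(1) by auto
qed

text \<open>Both \<open>a - b\<close> and \<open>a + b\<close> are too small for a nonzero multiple
  of \<open>N\<close>. The mirror image at 0 matters only for the last coordinate, the middle ones
  being positive.\<close>

lemma refl_kernel_0_rest:
  assumes "N > 0" "\<tau> \<in> {0, pi/2}" "a - b \<in> \<int>" "a + b \<in> \<int>"
    "2 * \<bar>a\<bar> < real N" "2 * \<bar>b\<bar> < real N"
  shows "refl_kernel N \<delta> \<tau> 0 a b = of_bool (a = b) + cos (2 * \<tau>) * of_bool (a + b = 0)"
proof -
  obtain c d where cd: "a - b = real_of_int c" "a + b = real_of_int d" using assms(3,4) by (auto elim!: Ints_cases)
  have "\<bar>c\<bar> < int N" "\<bar>d\<bar> < int N" using cd assms by linarith+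
  hence "int N dvd c \<longleftrightarrow> c = 0" "int N dvd d \<longleftrightarrow> d = 0"
    using zdvd_not_zless[of "\<bar>c\<bar>" "int N"] zdvd_not_zless[of "\<bar>d\<bar>" "int N"] by force+
  moreover have "a = b \<longleftrightarrow> c = 0" "a + b = 0 \<longleftrightarrow> d = 0" using cd by linarith+
  ultimately show ?thesis unfolding refl_kernel_0[OF assms(1,2) cd] by auto
qed

lemma strict_mono_permutes_id:
  fixes p :: "nat \<Rightarrow> nat"
  assumes "p permutes {0..<n}" "\<And>i j. i < j \<Longrightarrow> j < n \<Longrightarrow> p i < p j"
  shows "p = id"
proof -
  have "i \<le> p i" if "i < n" for i
    using that
  proof (induction i)
    case (Suc i)
    thus ?case using assms(2)[of i "Suc i"] by auto
  qed simp
  thus ?thesis using permutes_natset_ge[OF assms(1)] by auto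
qed

text \<open>A nonzero Leibniz term matches the increasing cosines of \<eta> with those of \<mu>,
  which forces the identity. The mirror images in the first and last coordinates cancel in the
  average over the four symmetries.\<close>

lemma refl_det_0:
  assumes "n \<ge> 2" "N > 0" "2 * m = real N"
    and "\<eta> \<in> alcove_D n m" "\<mu> \<in> alcove_D n m" "in_coset n c \<eta>" "in_coset n c \<mu>"
  shows "refl_det N 0 n \<eta> \<mu> = of_bool (\<eta> = \<mu>)"
proof -
  have m: "m > 0" using assms(2,3) by simp
  have C: "2 * pi * x / real N = pi * x / m" for x
    unfolding assms(3)[symmetric] by simp
  have ints: "\<eta> i - \<mu> j \<in> \<int>" "\<eta> i + \<mu> j \<in> \<int>" if "i \<in> {1..n}" "j \<in> {1..n}" for i j
    using in_coset_diff in_coset_add assms that by blast+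
  obtain l where l: "n = Suc (Suc l)" using assms(1) by (metis add_2_eq_Suc le_Suc_ex)
  define A where "A = (\<Prod>i<l. of_bool (\<eta> (i + 2) = \<mu> (i + 2)) :: real)"
  note b\<eta> = alcove_D_bounds[OF assms(1,4)] and b\<mu> = alcove_D_bounds[OF assms(1,5)]
  have det: "fdet n (\<lambda>i j. refl_kernel N \<delta> \<tau> 0 (\<eta> (Suc i)) (\<mu> (Suc j))) =
     (of_bool (\<eta> 1 = \<mu> 1) + cos (2 * \<tau>) * cos (2 * pi * \<delta>) * of_bool (\<eta> 1 + \<mu> 1 = real N)) * A *
     (of_bool (\<eta> n = \<mu> n) + cos (2 * \<tau>) * of_bool (\<eta> n + \<mu> n = 0))" if \<tau>: "\<tau> \<in> {0, pi/2}" for \<delta> \<tau>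
  proof -
    have "fdet n (\<lambda>i j. refl_kernel N \<delta> \<tau> 0 (\<eta> (Suc i)) (\<mu> (Suc j))) =
       (\<Prod>i=0..<n. refl_kernel N \<delta> \<tau> 0 (\<eta> (Suc i)) (\<mu> (Suc i)))"
    proof (rule fdet_diagonal)
      fix p assume p: "p permutes {0..<n}"
        and nz: "\<And>i. i < n \<Longrightarrow> refl_kernel N \<delta> \<tau> 0 (\<eta> (Suc i)) (\<mu> (Suc (p i))) \<noteq> 0"
      have pn: "p i < n" if "i < n" for i using permutes_in_image[OF p] that by simp
      have eq: "cos (pi * \<eta> (Suc i) / m) = cos (pi * \<mu> (Suc (p i)) / m)" if "i < n" for i
        using refl_kernel_0_nonzero[OF assms(2) \<tau> ints nz[OF that]] pn[OF that] that by (simp add: C)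
      show "p = id"
      proof (rule strict_mono_permutes_id[OF p])
        fix i j assume ij: "i < j" "j < n"
        have "cos (pi * \<mu> (Suc (p i)) / m) < cos (pi * \<mu> (Suc (p j)) / m)"
          using alcove_D_cos_strict_mono[OF assms(1,4) m, of "Suc i" "Suc j"] eq[of i] eq[of j] ij by simp
        moreover have "cos (pi * \<mu> (Suc (p j)) / m) \<le> cos (pi * \<mu> (Suc (p i)) / m)" if "p j \<le> p i"
          using alcove_D_cos_strict_mono[OF assms(1,5) m, of "Suc (p j)" "Suc (p i)"] pn[of i] ij that
          by (cases "p i = p j") auto
        ultimately show "p i < p j" by force
      qed
    qed
    also have "\<dots> = refl_kernel N \<delta> \<tau> 0 (\<eta> 1) (\<mu> 1) * (\<Prod>i<l. refl_kernel N \<delta> \<tau> 0 (\<eta> (i + 2)) (\<mu> (i + 2))) *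
         refl_kernel N \<delta> \<tau> 0 (\<eta> n) (\<mu> n)"
      unfolding l atLeast0LessThan by (subst prod.lessThan_Suc_shift) (simp add: prod.lessThan_Suc mult.assoc)
    also have "refl_kernel N \<delta> \<tau> 0 (\<eta> 1) (\<mu> 1) =
        of_bool (\<eta> 1 = \<mu> 1) + cos (2 * \<tau>) * cos (2 * pi * \<delta>) * of_bool (\<eta> 1 + \<mu> 1 = real N)"
      using refl_kernel_0_first[OF assms(2) \<tau>] ints[of 1 1] b\<eta>(1,2) b\<mu>(1,2) assms(1,3) by simp
    also have "refl_kernel N \<delta> \<tau> 0 (\<eta> n) (\<mu> n) = of_bool (\<eta> n = \<mu> n) + cos (2 * \<tau>) * of_bool (\<eta> n + \<mu> n = 0)"
      using refl_kernel_0_rest[OF assms(2) \<tau>] ints[of n n] b\<eta>(3)[of n] b\<mu>(3)[of n] assms(1,3) by simp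
    also have "(\<Prod>i<l. refl_kernel N \<delta> \<tau> 0 (\<eta> (i + 2)) (\<mu> (i + 2))) = A"
      unfolding A_def
    proof (intro prod.cong refl)
      fix i assume "i \<in> {..<l}"
      hence i: "2 \<le> i + 2" "i + 2 < n" "i + 2 \<le> n" by (auto simp: l)
      show "refl_kernel N \<delta> \<tau> 0 (\<eta> (i + 2)) (\<mu> (i + 2)) = of_bool (\<eta> (i + 2) = \<mu> (i + 2))"
        using refl_kernel_0_rest[OF assms(2) \<tau>, of "\<eta> (i + 2)" "\<mu> (i + 2)"] ints[of "i + 2" "i + 2"]
          b\<eta>(3)[of "i + 2"] b\<mu>(3)[of "i + 2"] b\<eta>(4)[of "i + 2"] b\<mu>(4)[of "i + 2"] i assms(3) by simp
    qed
    finally show ?thesis .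
  qed
  \<comment> \<open>With the signs u = \<open>cos (2 * \<tau>)\<close> and v =
    \<open>cos (2 * pi * \<delta>)\<close>, the unwanted terms carry u, uv and uuv = v, each of mean
    0.\<close>
  have "refl_det N 0 n \<eta> \<mu> = of_bool (\<eta> 1 = \<mu> 1) * A * of_bool (\<eta> n = \<mu> n)"
    unfolding refl_det_def by (simp add: det algebra_simps)
  also have "\<dots> = of_bool (\<forall>j\<in>{1..n}. \<eta> j = \<mu> j)"
  proof (cases "\<forall>j\<in>{1..n}. \<eta> j = \<mu> j")
    case False
    then obtain j where j: "j \<in> {1..n}" "\<eta> j \<noteq> \<mu> j" by blast
    have "A = 0" if "j \<noteq> 1" "j \<noteq> n"
    proof -
      have "j - 2 \<in> {..<l}" "j - 2 + 2 = j" using j that l by auto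
      thus ?thesis unfolding A_def using j by (intro prod_zero) (auto intro!: bexI[of _ "j - 2"])
    qed
    thus ?thesis using False j(2) by auto
  qed (auto simp: A_def l)
  also have "(\<forall>j\<in>{1..n}. \<eta> j = \<mu> j) \<longleftrightarrow> \<eta> = \<mu>"
    using assms(4,5) extensionalityI[of \<eta> "{1..n}" \<mu>] unfolding alcove_D_def by auto
  finally show ?thesis .
qed

text \<open>On a wall \<open>x h\<close> arises from \<open>x t\<close> by a sign change, a
  translation by \<open>N\<close>, both or neither, so two columns are proportional in each of the
  four determinants.\<close>

lemma refl_det_wall:
  assumes "N > 0" "1 \<le> h" "h < t" "t \<le> n"
    and "x h - x t \<in> {0, real N} \<or> x h + x t \<in> {0, real N}"
  shows "refl_det N k n \<eta> x = 0"
proof -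
  have "fdet n (\<lambda>i j. refl_kernel N \<delta> \<tau> k (\<eta> (Suc i)) (x (Suc j))) = 0"
    if \<delta>: "\<delta> \<in> {0, 1/2}" and \<tau>: "\<tau> \<in> {0, pi/2}" for \<delta> \<tau>
  proof -
    have "x h = x t \<or> x h = x t + real N \<or> x h = - x t \<or> x h = - x t + real N" using assms(5) by auto
    then obtain c where "\<And>a. refl_kernel N \<delta> \<tau> k a (x h) = c * refl_kernel N \<delta> \<tau> k a (x t)"
    proof (elim disjE)
      assume "x h = x t"
      thus ?thesis using that[of 1] by simp
    next
      assume "x h = x t + real N"
      thus ?thesis using that[of "cos (2 * pi * \<delta>)"] refl_kernel_period[OF assms(1) \<delta>] by simp
    next
      assume "x h = - x t"
      thus ?thesis using that[of "cos (2 * \<tau>)"] refl_kernel_minus[OF \<tau>] by simp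
    next
      assume "x h = - x t + real N"
      hence "refl_kernel N \<delta> \<tau> k a (x h) = cos (2 * pi * \<delta>) * cos (2 * \<tau>) * refl_kernel N \<delta> \<tau> k a (x t)" for a
        by (simp only: refl_kernel_period[OF assms(1) \<delta>] refl_kernel_minus[OF \<tau>] mult.assoc)
      thus ?thesis using that by blast
    qed
    thus ?thesis
      using fdet_proportional_columns[of "h - 1" n "t - 1"
          "\<lambda>i j. refl_kernel N \<delta> \<tau> k (\<eta> (Suc i)) (x (Suc j))" c] assms(2-4) by simp
  qed
  thus ?thesis unfolding refl_det_def by simp
qed

section \<open>Counting walks\<close>

text \<open>The signs \<open>e\<close> are indexed from 0 like matrix columns, hence
  \<open>j - 1\<close>. The restriction keeps the result extensional, as alcove points are.\<close>

definition shift :: "nat \<Rightarrow> (nat \<Rightarrow> real) \<Rightarrow> (nat \<Rightarrow> real) \<Rightarrow> nat \<Rightarrow> real" where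
  "shift n x e = restrict (\<lambda>j. x j + e (j - 1)) {1..n}"

lemma refl_det_Suc:
  assumes "N > 0"
  shows "refl_det N (Suc k) n \<eta> x = (\<Sum>e\<in>{0..<n} \<rightarrow>\<^sub>E {1/2, -1/2}. refl_det N k n \<eta> (shift n x e))"
proof -
  have "(\<Sum>e\<in>{0..<n} \<rightarrow>\<^sub>E {1/2, -1/2}. fdet n (\<lambda>i j. refl_kernel N \<delta> \<tau> k (\<eta> (Suc i)) (shift n x e (Suc j)))) =
     fdet n (\<lambda>i j. refl_kernel N \<delta> \<tau> (Suc k) (\<eta> (Suc i)) (x (Suc j)))" for \<delta> \<tau>
  proof -
    have "(\<Sum>e\<in>{0..<n} \<rightarrow>\<^sub>E {1/2, -1/2}. fdet n (\<lambda>i j. refl_kernel N \<delta> \<tau> k (\<eta> (Suc i)) (shift n x e (Suc j)))) =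
      (\<Sum>e\<in>{0..<n} \<rightarrow>\<^sub>E {1/2, -1/2}. fdet n (\<lambda>i j. refl_kernel N \<delta> \<tau> k (\<eta> (Suc i)) (x (Suc j) + e j)))"
      by (intro sum.cong refl fdet_cong) (simp add: shift_def)
    also have "\<dots> = fdet n (\<lambda>i j. \<Sum>s\<in>{1/2, -1/2}. refl_kernel N \<delta> \<tau> k (\<eta> (Suc i)) (x (Suc j) + s))"
      by (rule fdet_column_sums) simp
    also have "\<dots> = fdet n (\<lambda>i j. refl_kernel N \<delta> \<tau> (Suc k) (\<eta> (Suc i)) (x (Suc j)))"
      by (intro fdet_cong) (simp add: refl_kernel_Suc[OF assms])
    finally show ?thesis .
  qed
  thus ?thesis
    unfolding refl_det_def
    by (subst sum_divide_distrib[symmetric], subst sum.swap, subst sum.swap[of _ "{0, pi/2}"]) simp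
qed

text \<open>On a coset the roots take integer values, so inside the alcove these lie between 1 and
  \<open>N - 1\<close>. A step changes each by at most 1, so one that leaves the alcove puts some
  root exactly at 0 or \<open>N\<close>.\<close>

lemma refl_det_shift_outside:
  assumes "n \<ge> 2" "N > 0" "2 * m = real N" "x \<in> alcove_D n m" "in_coset n c x"
    and e: "e \<in> {0..<n} \<rightarrow>\<^sub>E {1/2, -1/2}" and out: "shift n x e \<notin> alcove_D n m"
  shows "refl_det N k n \<eta> (shift n x e) = 0"
proof -
  let ?y = "shift n x e"
  have "?y \<in> extensional {1..n}" by (simp add: shift_def)
  then obtain h t where ht: "1 \<le> h" "h < t" "t \<le> n" and bad:
    "\<not> (0 < ?y h - ?y t \<and> ?y h - ?y t < 2 * m \<and> 0 < ?y h + ?y t \<and> ?y h + ?y t < 2 * m)"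
    using out unfolding alcove_D_iff[OF assms(1)] by blast
  have x: "0 < x h - x t" "x h - x t < 2 * m" "0 < x h + x t" "x h + x t < 2 * m"
    using assms(4) ht unfolding alcove_D_iff[OF assms(1)] by blast+
  have "x h - x t \<in> \<int>" "x h + x t \<in> \<int>"
    using in_coset_diff[OF assms(5,5)] in_coset_add[OF assms(5,5)] ht by auto
  then obtain a b where ab: "x h - x t = real_of_int a" "x h + x t = real_of_int b" by (auto elim!: Ints_cases)
  have "0 < a" "a < int N" "0 < b" "b < int N" using x ab assms(3) by linarith+
  hence ab': "1 \<le> x h - x t" "x h - x t \<le> real N - 1" "1 \<le> x h + x t" "x h + x t \<le> real N - 1"
    unfolding ab by linarith+
  have "h - 1 \<in> {0..<n}" "t - 1 \<in> {0..<n}" using ht by auto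
  hence "e (h - 1) \<in> {1/2, -1/2}" "e (t - 1) \<in> {1/2, -1/2}" using e by (blast dest: PiE_mem)+
  moreover have "?y h = x h + e (h - 1)" "?y t = x t + e (t - 1)" using ht by (auto simp: shift_def)
  ultimately have "?y h - ?y t \<in> {0, real N} \<or> ?y h + ?y t \<in> {0, real N}"
    using bad ab' assms(3) by auto
  thus ?thesis using refl_det_wall[OF assms(2) ht] by blast
qed

lemma diagonal_walks_0: "diagonal_walks n R 0 \<eta> \<mu> = (if \<eta> = \<mu> \<and> \<eta> \<in> R then {\<lambda>i\<in>{0}. \<eta>} else {})"
  unfolding diagonal_walks_def by (auto simp: PiE_iff extensional_def intro!: ext)

lemma diagonal_walks_Suc:
  assumes "R \<subseteq> extensional {1..n}" "\<mu> \<in> R"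
  shows "diagonal_walks n R (Suc k) \<eta> \<mu> =
    (\<Union>e\<in>{0..<n} \<rightarrow>\<^sub>E {1/2, -1/2}. (\<lambda>p. p(Suc k := \<mu>)) ` diagonal_walks n R k \<eta> (shift n \<mu> e))"
    (is "?L = ?U")
proof (intro equalityI subsetI)
  fix p assume p: "p \<in> ?L"
  \<comment> \<open>This is the last step reversed; the set of sign patterns is closed under
    negation.\<close>
  define e where "e = (\<lambda>j\<in>{0..<n}. p k (Suc j) - \<mu> (Suc j))"
  have pR: "p \<in> {0..Suc k} \<rightarrow>\<^sub>E R" "p 0 = \<eta>" "p (Suc k) = \<mu>"
    and st: "\<And>i j. i \<in> {1..Suc k} \<Longrightarrow> j \<in> {1..n} \<Longrightarrow> p i j - p (i - 1) j \<in> {1/2, -1/2}"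
    using p unfolding diagonal_walks_def by auto
  have "e j \<in> {1/2, -1/2}" if "j < n" for j
    using st[of "Suc k" "Suc j"] that pR(3) by (auto simp: e_def)
  hence e: "e \<in> {0..<n} \<rightarrow>\<^sub>E {1/2, -1/2}" by (auto simp: e_def)
  have "p k \<in> extensional {1..n}" using pR(1) assms(1) by (auto simp: PiE_iff)
  hence sh: "p k = shift n \<mu> e"
    by (intro extensionalityI[of _ "{1..n}"]) (auto simp: shift_def e_def)
  have "restrict p {0..k} \<in> diagonal_walks n R k \<eta> (shift n \<mu> e)"
    unfolding diagonal_walks_def using pR st by (auto simp: sh[symmetric] PiE_iff)
  moreover have "p = (restrict p {0..k})(Suc k := \<mu>)"
    using pR by (auto simp: fun_eq_iff PiE_iff extensional_def)
  ultimately show "p \<in> ?U" using e by blast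
next
  fix p assume "p \<in> ?U"
  then obtain e q where e: "e \<in> {0..<n} \<rightarrow>\<^sub>E {1/2, -1/2}"
    and q: "q \<in> diagonal_walks n R k \<eta> (shift n \<mu> e)" and p: "p = q(Suc k := \<mu>)" by blast
  have qR: "q \<in> {0..k} \<rightarrow>\<^sub>E R" "q 0 = \<eta>" "q k = shift n \<mu> e"
    and st: "\<And>i j. i \<in> {1..k} \<Longrightarrow> j \<in> {1..n} \<Longrightarrow> q i j - q (i - 1) j \<in> {1/2, -1/2}"
    using q unfolding diagonal_walks_def by auto
  have "p i j - p (i - 1) j \<in> {1/2, -1/2}" if "i \<in> {1..Suc k}" "j \<in> {1..n}" for i j
  proof (cases "i = Suc k")
    case True
    have "e (j - 1) \<in> {1/2, -1/2}" using PiE_mem[OF e, of "j - 1"] that by auto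
    thus ?thesis using True that by (auto simp: p qR(3) shift_def)
  next
    case False
    thus ?thesis using st[of i j] that by (auto simp: p)
  qed
  thus "p \<in> ?L" using qR assms(2) unfolding diagonal_walks_def
    by (auto simp: p PiE_iff extensional_def)
qed

lemma finite_diagonal_walks:
  assumes "R \<subseteq> extensional {1..n}"
  shows "finite (diagonal_walks n R k \<eta> \<mu>)"
proof (induction k arbitrary: \<mu>)
  case 0
  show ?case by (simp add: diagonal_walks_0)
next
  case (Suc k)
  show ?case
  proof (cases "\<mu> \<in> R")
    case True
    show ?thesis unfolding diagonal_walks_Suc[OF assms True] by (intro finite_UN_I finite_PiE finite_imageI Suc) auto
  next
    case False
    hence "diagonal_walks n R (Suc k) \<eta> \<mu> = {}" by (auto simp: diagonal_walks_def PiE_iff)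
    thus ?thesis by simp
  qed
qed

text \<open>The sets of extended walks are disjoint because the penultimate point determines
  \<open>e\<close>.\<close>

lemma card_diagonal_walks_Suc:
  assumes "R \<subseteq> extensional {1..n}" "\<mu> \<in> R"
  shows "card (diagonal_walks n R (Suc k) \<eta> \<mu>) =
    (\<Sum>e\<in>{0..<n} \<rightarrow>\<^sub>E {1/2, -1/2}. card (diagonal_walks n R k \<eta> (shift n \<mu> e)))"
proof -
  let ?g = "\<lambda>e. (\<lambda>p. p(Suc k := \<mu>)) ` diagonal_walks n R k \<eta> (shift n \<mu> e)"
  have inj: "inj_on (\<lambda>p. p(Suc k := \<mu>)) (diagonal_walks n R k \<eta> y)" for y
  proof (rule inj_onI)
    fix p q assume "p \<in> diagonal_walks n R k \<eta> y" "q \<in> diagonal_walks n R k \<eta> y"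
      and eq: "p(Suc k := \<mu>) = q(Suc k := \<mu>)"
    \<comment> \<open>By extensionality both are \<open>undefined\<close> there.\<close>
    hence "p (Suc k) = q (Suc k)" unfolding diagonal_walks_def by (auto simp: PiE_iff extensional_def)
    thus "p = q" using eq by (metis fun_upd_triv fun_upd_upd)
  qed
  have disj: "?g e \<inter> ?g e' = {}"
    if e: "e \<in> {0..<n} \<rightarrow>\<^sub>E {1/2, -1/2}" "e' \<in> {0..<n} \<rightarrow>\<^sub>E {1/2, -1/2}" "e \<noteq> e'" for e e'
  proof (rule ccontr)
    assume "?g e \<inter> ?g e' \<noteq> {}"
    then obtain p q where "p \<in> diagonal_walks n R k \<eta> (shift n \<mu> e)" "q \<in> diagonal_walks n R k \<eta> (shift n \<mu> e')"
      and eq: "p(Suc k := \<mu>) = q(Suc k := \<mu>)" by blast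
    hence "p k = shift n \<mu> e" "q k = shift n \<mu> e'" unfolding diagonal_walks_def by auto
    moreover have "p k = q k" using fun_cong[OF eq, of k] by simp
    ultimately have *: "shift n \<mu> e = shift n \<mu> e'" by simp
    have "e j = e' j" if "j \<in> {0..<n}" for j
      using fun_cong[OF *, of "Suc j"] that by (simp add: shift_def)
    hence "e = e'" using e by (intro PiE_ext) auto
    thus False using e by simp
  qed
  show ?thesis
    unfolding diagonal_walks_Suc[OF assms]
    by (subst card_UN_disjoint) (use disj in \<open>auto simp: finite_diagonal_walks[OF assms(1)] card_image[OF inj] intro!: finite_PiE\<close>)
qed

text \<open>A step cannot jump over a wall, so the function \<open>refl_det\<close>, which obeys the walk recursion and
  vanishes on all walls, counts the walks.\<close>
lemma card_diagonal_walks_eq_refl_det: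
  assumes "n \<ge> 2" "N > 0" "2 * m = real N"
    and "\<eta> \<in> alcove_D n m" "\<mu> \<in> alcove_D n m" "in_coset n c \<eta>" "in_coset n (c + int k) \<mu>"
  shows "real (card (diagonal_walks n (alcove_D n m) k \<eta> \<mu>)) = refl_det N k n \<eta> \<mu>"
  using assms(5,7)
proof (induction k arbitrary: \<mu>)
  case 0
  thus ?case using refl_det_0[OF assms(1-4)] assms(4,6) by (simp add: diagonal_walks_0)
next
  case (Suc k)
  have R: "alcove_D n m \<subseteq> extensional {1..n}" by (auto simp: alcove_D_def)
  have "real (card (diagonal_walks n (alcove_D n m) k \<eta> (shift n \<mu> e))) = refl_det N k n \<eta> (shift n \<mu> e)"
    if e: "e \<in> {0..<n} \<rightarrow>\<^sub>E {1/2, -1/2}" for e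
  proof (cases "shift n \<mu> e \<in> alcove_D n m")
    case True
    have "in_coset n (c + int k) (shift n \<mu> e)"
      unfolding in_coset_def
    proof
      fix j assume j: "j \<in> {1..n}"
      have "e (j - 1) \<in> {1/2, -1/2}" using PiE_mem[OF e, of "j - 1"] j by auto
      hence "shift n \<mu> e j - of_int (c + int k) / 2 = \<mu> j - of_int (c + int (Suc k)) / 2 + 1 \<or>
             shift n \<mu> e j - of_int (c + int k) / 2 = \<mu> j - of_int (c + int (Suc k)) / 2"
        using j by (auto simp: shift_def field_simps)
      moreover have "\<mu> j - of_int (c + int (Suc k)) / 2 \<in> \<int>" using Suc.prems(2) j unfolding in_coset_def by blast
      ultimately show "shift n \<mu> e j - of_int (c + int k) / 2 \<in> \<int>" by (metis Ints_1 Ints_add)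
    qed
    thus ?thesis using Suc.IH True by blast
  next
    case False
    hence "p \<notin> diagonal_walks n (alcove_D n m) k \<eta> (shift n \<mu> e)" for p
      using PiE_mem[of p "{0..k}" "\<lambda>_. alcove_D n m" k] by (auto simp: diagonal_walks_def)
    hence "diagonal_walks n (alcove_D n m) k \<eta> (shift n \<mu> e) = {}" by blast
    thus ?thesis using refl_det_shift_outside[OF assms(1-3) Suc.prems e False] by simp
  qed
  thus ?case
    unfolding card_diagonal_walks_Suc[OF R Suc.prems(1)] refl_det_Suc[OF assms(2)] by simp
qed

section \<open>Frequencies and the leading term\<close>

text \<open>An exchange argument: \<open>D\<close> has as many elements outside
  \<open>{..<n}\<close> as it misses inside. For \<open>n > 0\<close> the former have values below
  \<open>l (n - 1)\<close>, the latter at least that value.\<close>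

lemma prod_strict_antimono_bound:
  fixes l :: "nat \<Rightarrow> real"
  assumes D: "D \<subseteq> {..M}" "card D = n"
    and anti: "\<And>i j. i < j \<Longrightarrow> j \<le> M \<Longrightarrow> l j < l i" and nonneg: "\<And>i. i \<le> M \<Longrightarrow> 0 \<le> l i"
  shows "prod l D \<le> prod l {..<n}"
    and "D \<noteq> {..<n} \<Longrightarrow> (\<And>i. i < n \<Longrightarrow> 0 < l i) \<Longrightarrow> prod l D < prod l {..<n}"
proof -
  have fin: "finite D" using D(1) finite_subset by blast
  have nM: "n \<le> Suc M" using card_mono[OF _ D(1)] D(2) by simp
  define A B where "A = D - {..<n}" and "B = {..<n} - D"
  define c where "c = l (n - 1)"
  have "card A = card B"
    unfolding A_def B_def using card_Diff_subset_Int[of D "{..<n}"] card_Diff_subset_Int[of "{..<n}" D] fin D(2)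
    by (simp add: Int_commute)
  have split: "prod l D = prod l (D \<inter> {..<n}) * prod l A" "prod l {..<n} = prod l (D \<inter> {..<n}) * prod l B"
    unfolding A_def B_def
    using prod.Int_Diff[OF fin, of l "{..<n}"] prod.Int_Diff[of "{..<n}" l D] by (simp_all only: Int_commute[of "{..<n}" D] finite_lessThan)
  have common: "0 \<le> prod l (D \<inter> {..<n})" using D(1) nonneg by (intro prod_nonneg) auto
  have A: "0 \<le> l i \<and> l i < c" if "i \<in> A" "n > 0" for i
    using that D(1) nonneg anti[of "n - 1" i] unfolding A_def c_def by auto
  have B: "0 \<le> c \<and> c \<le> l i" if "i \<in> B" for i
  proof -
    have i: "i \<le> n - 1" "n - 1 \<le> M" using that nM by (auto simp: B_def)
    thus ?thesis
      using nonneg[of "n - 1"] anti[of i "n - 1"] unfolding c_def by (cases "i = n - 1") auto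
  qed
  have Bge: "c ^ card B \<le> prod l B"
    using prod_mono[of B "\<lambda>_. c" l] B by simp
  have "prod l A \<le> prod l B"
  proof (cases "n = 0")
    case True
    thus ?thesis using D fin by (simp add: A_def B_def)
  next
    case False
    thus ?thesis using prod_mono[of A l "\<lambda>_. c"] A Bge \<open>card A = card B\<close> by force
  qed
  thus "prod l D \<le> prod l {..<n}" unfolding split using common by (rule mult_left_mono)
  assume ne: "D \<noteq> {..<n}" and pos: "\<And>i. i < n \<Longrightarrow> 0 < l i"
  have "A \<noteq> {}"
  proof
    assume "A = {}"
    hence "D \<subseteq> {..<n}" by (auto simp: A_def)
    thus False using ne card_subset_eq[of "{..<n}" D] D(2) by simp
  qed
  then obtain a where a: "a \<in> A" by blast
  have n: "n > 0" using a D(2) fin by (cases n) (auto simp: A_def)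
  have "prod l A < prod (\<lambda>_. c) A"
    using A n pos[of "n - 1"] a fin
    by (intro prod_mono_strict[of a]) (auto simp: A_def c_def less_imp_le)
  hence "prod l A < prod l B" using Bge \<open>card A = card B\<close> by simp
  moreover have "0 < prod l (D \<inter> {..<n})" using pos by (intro prod_pos) auto
  ultimately show "prod l D < prod l {..<n}" unfolding split by simp
qed

section \<open>Folding the frequencies to half of their range\<close>

text \<open>On the coset \<open>2 * pi * x\<close> equals \<open>pi * of_int c\<close> up to full
  turns, so the frequency \<open>N - z\<close> acts like \<open>- z\<close> up to a sign. The total
  sign depends on neither \<open>x\<close> nor \<open>z\<close> and cancels in a product of two
  waves.\<close>

lemma wave_reflect:
  assumes "N > 0" "\<tau> \<in> {0, pi/2}" "x - of_int c / 2 \<in> \<int>"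
  shows "wave N \<tau> (real N - z) x = cos (pi * of_int c) * cos (2 * \<tau>) * wave N \<tau> z x"
proof -
  obtain r where "x - of_int c / 2 = of_int r" using assms(3) by (auto elim: Ints_cases)
  hence x: "2 * pi * x = 2 * pi * of_int r + pi * of_int c" by (simp add: field_simps)
  have "2 * pi * (real N - z) * x / real N - \<tau> = (2 * pi * (- z) * x / real N - \<tau>) + pi * of_int c + 2 * pi * of_int r"
  proof -
    have "2 * pi * (real N - z) * x / real N = 2 * pi * x - 2 * pi * z * x / real N"
      using assms(1) by (simp add: field_simps)
    thus ?thesis unfolding x by simp
  qed
  hence "wave N \<tau> (real N - z) x = cos ((2 * pi * (- z) * x / real N - \<tau>) + pi * of_int c)"
    unfolding wave_def by (simp only: cos_add[of _ "2 * pi * real_of_int _"] cos_int_2pin sin_int_2pin)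
  also have "\<dots> = cos (pi * of_int c) * wave N \<tau> (- z) x"
    using sin_int_times_real[of c pi] sin_npi_int[of c]
    unfolding wave_def by (simp add: cos_add mult.commute)
  finally show ?thesis using wave_minus(2)[OF assms(2)] by simp
qed

text \<open>From here on \<open>s \<in> {0, 1}\<close> encodes the offset \<open>\<delta> = s/2\<close>; folding sends the frequency \<open>\<nu> + \<delta>\<close> to its
  distance from \<open>{0, N}\<close>, again with offset \<open>\<delta>\<close>.\<close>
definition fold_weight :: "nat \<Rightarrow> nat \<Rightarrow> nat \<Rightarrow> nat" where
  "fold_weight N s d = card {\<nu>. \<nu> < N \<and> min \<nu> (N - s - \<nu>) = d}"

text \<open>Frequency 0 counts once, as its mirror image \<open>N\<close> is not below
  \<open>N\<close>; any other \<open>d\<close> below \<open>N / 2\<close> also arises from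
  \<open>N - d\<close>.\<close>

lemma fold_weight_0:
  assumes "2 * d < N"
  shows "fold_weight N 0 d = (if d = 0 then 1 else 2)"
proof (cases "d = 0")
  case True
  have "{\<nu>. \<nu> < N \<and> min \<nu> (N - 0 - \<nu>) = 0} = {0}" using assms by (auto simp: min_def split: if_splits)
  thus ?thesis using True by (simp add: fold_weight_def)
next
  case False
  have "{\<nu>. \<nu> < N \<and> min \<nu> (N - 0 - \<nu>) = d} = {d, N - d}" using assms False by (auto simp: min_def split: if_splits)
  moreover have "d \<noteq> N - d" using assms by auto
  ultimately show ?thesis using False by (simp add: fold_weight_def)
qed

text \<open>The frequencies \<open>z\<close> and \<open>N - z\<close> contribute equally: the even
  power absorbs the sign of the eigenvalue, and the signs of the two waves multiply to 1.\<close>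

lemma refl_kernel_fold:
  assumes "N > 0" "\<tau> \<in> {0, pi/2}" "s \<le> 1" "even k" "a - of_int c / 2 \<in> \<int>" "b - of_int c / 2 \<in> \<int>"
  shows "refl_kernel N (real s / 2) \<tau> k a b = (\<Sum>d | 2 * d + s \<le> N.
     (2 / real N * real (fold_weight N s d) * (2 * cos (pi * (real d + real s / 2) / real N)) ^ k) *
       wave N \<tau> (real d + real s / 2) a * wave N \<tau> (real d + real s / 2) b)"
proof -
  define t where "t z = (2 * cos (pi * z / real N)) ^ k * wave N \<tau> z a * wave N \<tau> z b" for z
  have u: "cos (2 * \<tau>) * cos (2 * \<tau>) = 1"
    using assms(2) unfolding insert_iff empty_iff by (safe; simp)
  have v: "cos (pi * real_of_int c) * cos (pi * real_of_int c) = 1"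
    using sin_npi_int[of c] sin_cos_squared_add[of "pi * real_of_int c"] by (simp add: power2_eq_square mult.commute)
  have t: "t (real N - z) = t z" for z
  proof -
    have "pi * (real N - z) / real N = pi - pi * z / real N" using assms(1) by (simp add: field_simps)
    hence "(2 * cos (pi * (real N - z) / real N)) ^ k = (2 * cos (pi * z / real N)) ^ k"
      using assms(4) by (simp add: power_mult_distrib)
    moreover have "wave N \<tau> (real N - z) a * wave N \<tau> (real N - z) b =
       (cos (pi * of_int c) * cos (pi * of_int c)) * (cos (2 * \<tau>) * cos (2 * \<tau>)) * (wave N \<tau> z a * wave N \<tau> z b)"
      unfolding wave_reflect[OF assms(1,2,5)] wave_reflect[OF assms(1,2,6)] by (simp only: mult_ac)
    ultimately show ?thesis unfolding t_def u v by (simp add: mult.assoc)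
  qed
  \<comment> \<open>As \<open>\<nu> < N\<close> and \<open>s \<le> 1\<close>, the subtraction is not
    truncated. With the offset \<open>s / 2\<close> added, \<open>N - s - \<nu>\<close> stands for
    the mirrored frequency \<open>N - (\<nu> + s / 2)\<close>.\<close>
  let ?\<phi> = "\<lambda>\<nu>. min \<nu> (N - s - \<nu>)"
  have "(\<Sum>\<nu><N. t (real \<nu> + real s / 2)) = (\<Sum>\<nu><N. t (real (?\<phi> \<nu>) + real s / 2))"
  proof (intro sum.cong refl)
    fix \<nu> assume "\<nu> \<in> {..<N}"
    hence "real (?\<phi> \<nu>) + real s / 2 = real \<nu> + real s / 2 \<or> real (?\<phi> \<nu>) + real s / 2 = real N - (real \<nu> + real s / 2)"
      using assms(3) by (auto simp: min_def of_nat_diff field_simps)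
    thus "t (real \<nu> + real s / 2) = t (real (?\<phi> \<nu>) + real s / 2)" using t by metis
  qed
  also have "\<dots> = (\<Sum>d | 2 * d + s \<le> N. \<Sum>\<nu> | \<nu> \<in> {..<N} \<and> ?\<phi> \<nu> = d. t (real (?\<phi> \<nu>) + real s / 2))"
  proof (rule sum.group[symmetric])
    show "finite {d. 2 * d + s \<le> N}" by (rule finite_subset[of _ "{..N}"]) auto
    show "?\<phi> ` {..<N} \<subseteq> {d. 2 * d + s \<le> N}" using assms(3) by (auto simp: min_def)
  qed simp
  also have "\<dots> = (\<Sum>d | 2 * d + s \<le> N. real (fold_weight N s d) * t (real d + real s / 2))"
    by (intro sum.cong refl) (simp add: fold_weight_def)
  finally show ?thesis
    unfolding refl_kernel_def t_def by (simp add: sum_distrib_left mult.assoc mult.left_commute)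
qed

section \<open>Expansion of the determinants into modes\<close>

text \<open>A mode chooses a folded frequency for each matrix row. This is the factor of its
  Cauchy--Binet term that is raised to the power \<open>k\<close>.\<close>

definition mode_eigen :: "nat \<Rightarrow> nat \<Rightarrow> nat \<Rightarrow> (nat \<Rightarrow> nat) \<Rightarrow> real" where
  "mode_eigen N s n d = (\<Prod>i=0..<n. 2 * cos (pi * (real (d i) + real s / 2) / real N))"

definition mode_coeff ::
  "nat \<Rightarrow> nat \<Rightarrow> real \<Rightarrow> nat \<Rightarrow> (nat \<Rightarrow> real) \<Rightarrow> (nat \<Rightarrow> real) \<Rightarrow> (nat \<Rightarrow> nat) \<Rightarrow> real" where
  "mode_coeff N s \<tau> n \<eta> \<mu> d =
     (\<Prod>i=0..<n. 2 / real N * real (fold_weight N s (d i))) *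
     (\<Prod>i=0..<n. wave N \<tau> (real (d i) + real s / 2) (\<eta> (Suc i))) *
     fdet n (\<lambda>i j. wave N \<tau> (real (d i) + real s / 2) (\<mu> (Suc j)))"

definition modes :: "nat \<Rightarrow> nat \<Rightarrow> nat \<Rightarrow> (nat \<Rightarrow> nat) set" where
  "modes N s n = {0..<n} \<rightarrow>\<^sub>E {d. 2 * d + s \<le> N}"

lemma finite_modes: "finite (modes N s n)"
proof -
  have "finite {d. 2 * d + s \<le> N}" by (rule finite_subset[of _ "{..N}"]) auto
  thus ?thesis unfolding modes_def by (intro finite_PiE) auto
qed

lemma refl_det_modes:
  assumes "N > 0" "even k" "in_coset n c \<eta>" "in_coset n c \<mu>"
  shows "refl_det N k n \<eta> \<mu> =
    (\<Sum>s\<in>{0, 1}. \<Sum>\<tau>\<in>{0, pi/2}. \<Sum>d\<in>modes N s n. mode_eigen N s n d ^ k * mode_coeff N s \<tau> n \<eta> \<mu> d) / 4"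
proof -
  have "fdet n (\<lambda>i j. refl_kernel N (real s / 2) \<tau> k (\<eta> (Suc i)) (\<mu> (Suc j))) =
     (\<Sum>d\<in>modes N s n. mode_eigen N s n d ^ k * mode_coeff N s \<tau> n \<eta> \<mu> d)"
    if s: "s \<le> 1" and \<tau>: "\<tau> \<in> {0, pi/2}" for s \<tau>
  proof -
    let ?S = "{d. 2 * d + s \<le> N}"
    let ?c = "\<lambda>d. 2 / real N * real (fold_weight N s d) * (2 * cos (pi * (real d + real s / 2) / real N)) ^ k"
    let ?w = "\<lambda>d. wave N \<tau> (real d + real s / 2)"
    have fin: "finite ?S" by (rule finite_subset[of _ "{..N}"]) auto
    have "fdet n (\<lambda>i j. refl_kernel N (real s / 2) \<tau> k (\<eta> (Suc i)) (\<mu> (Suc j))) =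
       fdet n (\<lambda>i j. \<Sum>d\<in>?S. ?c d * ?w d (\<eta> (Suc i)) * ?w d (\<mu> (Suc j)))"
    proof (rule fdet_cong)
      fix i j assume "i < n" "j < n"
      hence "\<eta> (Suc i) - of_int c / 2 \<in> \<int>" "\<mu> (Suc j) - of_int c / 2 \<in> \<int>"
        using assms(3,4) by (auto simp: in_coset_def)
      thus "refl_kernel N (real s / 2) \<tau> k (\<eta> (Suc i)) (\<mu> (Suc j)) =
         (\<Sum>d\<in>?S. ?c d * ?w d (\<eta> (Suc i)) * ?w d (\<mu> (Suc j)))"
        by (rule refl_kernel_fold[OF assms(1) \<tau> s assms(2)])
    qed
    also have "\<dots> = (\<Sum>d\<in>modes N s n. (\<Prod>i=0..<n. ?c (d i)) * (\<Prod>i=0..<n. ?w (d i) (\<eta> (Suc i))) *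
        fdet n (\<lambda>i j. ?w (d i) (\<mu> (Suc j))))"
      unfolding modes_def by (rule fdet_sum_expand[OF fin])
    also have "\<dots> = (\<Sum>d\<in>modes N s n. mode_eigen N s n d ^ k * mode_coeff N s \<tau> n \<eta> \<mu> d)"
    proof (intro sum.cong refl)
      fix d
      have "(\<Prod>i=0..<n. ?c (d i)) = (\<Prod>i=0..<n. 2 / real N * real (fold_weight N s (d i))) * mode_eigen N s n d ^ k"
        unfolding mode_eigen_def prod_power_distrib prod.distrib[symmetric] by (rule refl)
      thus "(\<Prod>i=0..<n. ?c (d i)) * (\<Prod>i=0..<n. ?w (d i) (\<eta> (Suc i))) * fdet n (\<lambda>i j. ?w (d i) (\<mu> (Suc j))) =
        mode_eigen N s n d ^ k * mode_coeff N s \<tau> n \<eta> \<mu> d"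
        unfolding mode_coeff_def by (simp only: mult_ac)
    qed
    finally show ?thesis .
  qed
  from this[of 0] this[of 1] show ?thesis unfolding refl_det_def by simp
qed

text \<open>Equal frequencies produce equal rows.\<close>

lemma mode_coeff_nonzero_inj:
  assumes "mode_coeff N s \<tau> n \<eta> \<mu> d \<noteq> 0"
  shows "inj_on d {0..<n}"
proof (rule inj_onI, rule ccontr)
  fix i j assume "i \<in> {0..<n}" "j \<in> {0..<n}" "d i = d j" "i \<noteq> j"
  hence "fdet n (\<lambda>i j. wave N \<tau> (real (d i) + real s / 2) (\<mu> (Suc j))) = 0"
    by (intro fdet_equal_rows[of i n j]) auto
  thus False using assms by (simp add: mode_coeff_def)
qed

text \<open>Dropping the offset only increases the eigenvalue, strictly if \<open>s = 1\<close>;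
  then \<open>n\<close> distinct frequencies do no better than \<open>{0..<n}\<close>. That they fit
  below \<open>N / 2\<close> gives the size bound.\<close>

lemma mode_eigen_bounds:
  assumes "n > 0" "N > 0" "s \<le> 1" "d \<in> modes N s n" "mode_coeff N s \<tau> n \<eta> \<mu> d \<noteq> 0"
  shows "0 \<le> mode_eigen N s n d" "mode_eigen N s n d \<le> (\<Prod>j<n. 2 * cos (pi * real j / real N))"
    "2 * (n - 1) \<le> N"
    "2 * (n - 1) < N \<Longrightarrow> (s, \<tau>) \<noteq> (0, 0) \<Longrightarrow> \<tau> \<in> {0, pi/2} \<Longrightarrow>
       mode_eigen N s n d < (\<Prod>j<n. 2 * cos (pi * real j / real N))"
    "2 * (n - 1) < N \<Longrightarrow> d ` {0..<n} \<noteq> {0..<n} \<Longrightarrow>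
       mode_eigen N s n d < (\<Prod>j<n. 2 * cos (pi * real j / real N))"
proof -
  define l where "l = (\<lambda>z. 2 * cos (pi * z / real N))"
  define D where "D = d ` {0..<n}"
  note inj = mode_coeff_nonzero_inj[OF assms(5)]
  have card: "card D = n" unfolding D_def by (simp add: card_image[OF inj])
  have d: "2 * d i + s \<le> N" if "i < n" for i
    using assms(4) that by (auto simp: modes_def PiE_iff)
  have D: "D \<subseteq> {..N div 2}"
  proof -
    have "d i \<le> N div 2" if "i < n" for i using d[OF that] by linarith
    thus ?thesis by (auto simp: D_def)
  qed
  have l_anti: "l y < l z" if "0 \<le> z" "z < y" "2 * y \<le> real N" for y z
  proof -
    have "pi * (y / real N) \<le> pi * 1" using that assms(2) by (intro mult_left_mono) auto
    thus ?thesis unfolding l_def using that assms(2)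
      by (simp, intro cos_monotone_0_pi) (auto intro!: divide_strict_right_mono mult_strict_left_mono)
  qed
  have l_half: "l (real N / 2) = 0" using assms(2) by (simp add: l_def)
  have l_pos: "0 < l z" if "0 \<le> z" "2 * z < real N" for z
    using l_anti[of z "real N / 2"] l_half that by simp
  have l_nonneg: "0 \<le> l z" if "0 \<le> z" "2 * z \<le> real N" for z
  proof (cases "2 * z = real N")
    case True
    hence "z = real N / 2" by simp
    thus ?thesis by (simp only: l_half order_refl)
  next
    case False
    thus ?thesis using l_pos[of z] that by simp
  qed
  have nN: "n \<le> Suc (N div 2)" using card_mono[OF _ D] card by simp
  thus "2 * (n - 1) \<le> N" by linarith
  have E: "mode_eigen N s n d = (\<Prod>i=0..<n. l (real (d i) + real s / 2))"
    by (simp add: mode_eigen_def l_def)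
  have real_d: "2 * (real (d i) + real s / 2) \<le> real N" if "i < n" for i
    using d[OF that] by simp
  show "0 \<le> mode_eigen N s n d"
    unfolding E using real_d by (intro prod_nonneg) (auto intro!: l_nonneg)
  have prodD: "(\<Prod>i=0..<n. l (real (d i))) = (\<Prod>x\<in>D. l (real x))"
    unfolding D_def by (simp add: prod.reindex[OF inj])
  have anti_nat: "l (real j) < l (real i)" if "i < j" "j \<le> N div 2" for i j
    using that by (intro l_anti) auto
  have nonneg_nat: "0 \<le> l (real i)" if "i \<le> N div 2" for i
    using that by (intro l_nonneg) auto
  have step: "l (real (d i) + real s / 2) \<le> l (real (d i))" "0 \<le> l (real (d i) + real s / 2)" if "i < n" for i
    using l_anti[of "real (d i)" "real (d i) + real s / 2"] l_nonneg[of "real (d i) + real s / 2"] real_d[OF that]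
    by (cases "s = 0"; force)+
  have le1: "mode_eigen N s n d \<le> (\<Prod>x\<in>D. l (real x))"
    unfolding E prodD[symmetric] using step by (intro prod_mono) auto
  have le2: "(\<Prod>x\<in>D. l (real x)) \<le> (\<Prod>j<n. l (real j))"
    by (rule prod_strict_antimono_bound(1)[OF D card anti_nat nonneg_nat])
  show "mode_eigen N s n d \<le> (\<Prod>j<n. 2 * cos (pi * real j / real N))"
    using le1 le2 by (simp add: l_def)
  have less2: "(\<Prod>x\<in>D. l (real x)) < (\<Prod>j<n. l (real j))" if "D \<noteq> {..<n}" "2 * (n - 1) < N"
  proof (rule prod_strict_antimono_bound(2)[OF D card anti_nat nonneg_nat that(1)])
    fix i assume "i < n"
    hence "2 * i < N" using that(2) by linarith
    thus "0 < l (real i)" by (intro l_pos) auto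
  qed
  show "mode_eigen N s n d < (\<Prod>j<n. 2 * cos (pi * real j / real N))"
    if "2 * (n - 1) < N" "d ` {0..<n} \<noteq> {0..<n}"
    using le1 less2 that by (simp add: l_def D_def lessThan_atLeast0)
  show "mode_eigen N s n d < (\<Prod>j<n. 2 * cos (pi * real j / real N))"
    if "2 * (n - 1) < N" "(s, \<tau>) \<noteq> (0, 0)" "\<tau> \<in> {0, pi/2}"
  proof (cases "s = 0")
    case True
    hence \<tau>: "\<tau> = pi / 2" using that by auto
    \<comment> \<open>The sine wave of frequency 0 vanishes identically, so modes using it have
      coefficient 0.\<close>
    have "D \<noteq> {..<n}"
    proof
      assume "D = {..<n}"
      hence "0 \<in> d ` {0..<n}" using assms(1) unfolding D_def by simp
      then obtain i where "i \<in> {0..<n}" "d i = 0" by auto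
      hence "(\<Prod>i=0..<n. wave N \<tau> (real (d i) + real s / 2) (\<eta> (Suc i))) = 0"
        unfolding \<tau> using True by (intro prod_zero bexI[of _ i]) (auto simp: wave_def)
      thus False using assms(5) by (simp add: mode_coeff_def)
    qed
    thus ?thesis using le1 less2 that(1) by (simp add: l_def)
  next
    case False
    have lt: "l (real (d i) + real s / 2) < l (real (d i))" if "i < n" for i
      using l_anti[of "real (d i)" "real (d i) + real s / 2"] real_d[OF that] False by simp
    hence "mode_eigen N s n d < (\<Prod>i=0..<n. l (real (d i)))"
      unfolding E using step assms(1) by (intro prod_mono_strict[of 0]) (force intro: le_less_trans)+
    thus ?thesis using prodD le2 by (simp add: l_def)
  qed
qed

section \<open>Chebyshev--Vandermonde determinants\<close>

text \<open>Chebyshev polynomials in the Newton basis with nodes \<open>y\<close>. The three-term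
  recurrence applies because \<open>cos \<theta>\<close> times the \<open>l\<close>-th basis element
  is the next one plus \<open>y l\<close> times the \<open>l\<close>-th.\<close>

lemma cos_multiple_newton:
  fixes y :: "nat \<Rightarrow> real"
  shows "\<exists>c. c i = (if i = 0 then 1 else 2 ^ (i - 1)) \<and>
    (\<forall>\<theta>. cos (real i * \<theta>) = (\<Sum>l\<le>i. c l * (\<Prod>h<l. cos \<theta> - y h)))"
proof (induction i rule: less_induct)
  case (less i)
  consider "i = 0" | "i = 1" | i' where "i = Suc (Suc i')"
    by (metis One_nat_def old.nat.exhaust)
  thus ?case
  proof cases
    case 1
    thus ?thesis by (intro exI[of _ "\<lambda>_. 1"]) simp
  next
    case 2
    \<comment> \<open>Here \<open>cos \<theta> = y 0 + (cos \<theta> - y 0)\<close>.\<close>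
    thus ?thesis by (intro exI[of _ "\<lambda>l. if l = 0 then y 0 else 1"]) simp
  next
    case 3
    obtain c0 where c0: "\<And>\<theta>. cos (real i' * \<theta>) = (\<Sum>l\<le>i'. c0 l * (\<Prod>h<l. cos \<theta> - y h))"
      using less[of i'] 3 by auto
    obtain c1 where c1: "c1 (Suc i') = 2 ^ i'"
      "\<And>\<theta>. cos (real (Suc i') * \<theta>) = (\<Sum>l\<le>Suc i'. c1 l * (\<Prod>h<l. cos \<theta> - y h))"
      using less[of "Suc i'"] 3 by (auto simp del: of_nat_Suc)
    \<comment> \<open>\<open>A\<close> collects the shifted basis elements, \<open>B\<close> the
      node multiples and \<open>C\<close> the polynomial of degree \<open>i - 2\<close>, all padded
      by 0. Only \<open>A\<close> reaches the top index, so the leading coefficient doubles.\<close>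
    define A where "A l = (case l of 0 \<Rightarrow> 0 | Suc l \<Rightarrow> c1 l)" for l
    define B where "B l = (if l \<le> Suc i' then y l * c1 l else 0)" for l
    define C where "C l = (if l \<le> i' then c0 l else 0)" for l
    have "cos (real i * \<theta>) = (\<Sum>l\<le>i. (2 * A l + 2 * B l - C l) * (\<Prod>h<l. cos \<theta> - y h))" for \<theta>
    proof -
      let ?N = "\<lambda>l. \<Prod>h<l. cos \<theta> - y h"
      have "cos (real i * \<theta>) = 2 * (cos \<theta> * cos (real (Suc i') * \<theta>)) - cos (real i' * \<theta>)"
      proof -
        have "real i * \<theta> = real (Suc i') * \<theta> + \<theta>" "real i' * \<theta> = real (Suc i') * \<theta> - \<theta>"
          unfolding 3 by (simp_all add: algebra_simps)
        thus ?thesis by (simp only: cos_add cos_diff) simp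
      qed
      also have "cos \<theta> * cos (real (Suc i') * \<theta>) = (\<Sum>l\<le>Suc i'. c1 l * ?N (Suc l)) + (\<Sum>l\<le>Suc i'. y l * c1 l * ?N l)"
        unfolding c1(2) sum_distrib_left sum.distrib[symmetric]
        by (intro sum.cong refl) (simp add: algebra_simps)
      also have "(\<Sum>l\<le>Suc i'. c1 l * ?N (Suc l)) = (\<Sum>l\<le>i. A l * ?N l)"
        unfolding 3 sum.atMost_Suc_shift[of _ "Suc i'"] by (simp add: A_def)
      also have "(\<Sum>l\<le>Suc i'. y l * c1 l * ?N l) = (\<Sum>l\<le>i. B l * ?N l)"
        unfolding 3 by (simp add: B_def)
      also have "cos (real i' * \<theta>) = (\<Sum>l\<le>i. C l * ?N l)"
        unfolding 3 c0 by (simp add: C_def)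
      finally show ?thesis
        by (simp add: algebra_simps sum.distrib sum_subtractf sum_distrib_left)
    qed
    moreover have "2 * A i + 2 * B i - C i = 2 ^ (i - 1)"
      unfolding 3 by (simp add: A_def B_def C_def c1(1))
    ultimately show ?thesis using 3 by (intro exI[of _ "\<lambda>l. 2 * A l + 2 * B l - C l"]) auto
  qed
qed

text \<open>In the Newton basis at the nodes \<open>cos (x j)\<close> the Chebyshev--Vandermonde matrix factors into a lower
  and an upper triangular matrix.\<close>
lemma fdet_cos_multiples:
  "fdet n (\<lambda>i j. cos (real i * x j)) =
    (\<Prod>i<n. if i = 0 then 1 else 2 ^ (i - 1)) * (\<Prod>j<n. \<Prod>h<j. cos (x j) - cos (x h))"
proof -
  obtain c :: "nat \<Rightarrow> nat \<Rightarrow> real" where c: "\<And>i. c i i = (if i = 0 then 1 else 2 ^ (i - 1))"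
    "\<And>i \<theta>. cos (real i * \<theta>) = (\<Sum>l\<le>i. c i l * (\<Prod>h<l. cos \<theta> - cos (x h)))"
    using cos_multiple_newton[of _ "\<lambda>h. cos (x h)"] by metis
  define L where "L = mat n n (\<lambda>(i, l). if l \<le> i then c i l else 0)"
  define U where "U = mat n n (\<lambda>(l, j). \<Prod>h<l. cos (x j) - cos (x h))"
  have LU: "L \<in> carrier_mat n n" "U \<in> carrier_mat n n" by (simp_all add: L_def U_def)
  have "mat n n (\<lambda>(i, j). cos (real i * x j)) = L * U"
  proof (rule eq_matI)
    fix i j assume ij: "i < dim_row (L * U)" "j < dim_col (L * U)"
    hence ij: "i < n" "j < n" using LU by auto
    have "(\<Sum>l\<le>i. c i l * (\<Prod>h<l. cos (x j) - cos (x h))) =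
       (\<Sum>l\<in>{0..<n}. (if l \<le> i then c i l else 0) * (\<Prod>h<l. cos (x j) - cos (x h)))"
      using ij by (intro sum.mono_neutral_cong_left) auto
    thus "mat n n (\<lambda>(i, j). cos (real i * x j)) $$ (i, j) = (L * U) $$ (i, j)"
      using ij by (simp add: L_def U_def scalar_prod_def c(2))
  qed (use LU in auto)
  hence "fdet n (\<lambda>i j. cos (real i * x j)) = det L * det U"
    unfolding fdet_def using det_mult[OF LU] by simp
  also have "det L = (\<Prod>i<n. if i = 0 then 1 else 2 ^ (i - 1))"
  proof -
    have "det L = prod_list (diag_mat L)"
      by (rule det_lower_triangular[OF _ LU(1)]) (simp add: L_def)
    thus ?thesis unfolding prod_list_diag_prod lessThan_atLeast0
      by (auto simp: L_def c(1) intro!: prod.cong)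
  qed
  also have "det U = (\<Prod>j<n. \<Prod>h<j. cos (x j) - cos (x h))"
  proof -
    have "upper_triangular U"
      unfolding upper_triangular_def U_def by (auto intro!: prod_zero)
    hence "det U = prod_list (diag_mat U)" by (rule det_upper_triangular[OF _ LU(2)])
    thus ?thesis unfolding prod_list_diag_prod by (simp add: U_def atLeast0LessThan)
  qed
  finally show ?thesis .
qed

lemma fdet_transpose: "fdet n (\<lambda>i j. A j i) = fdet n A"
  unfolding fdet_def
  by (subst det_transpose[symmetric, of _ n]) (auto intro!: arg_cong[of _ _ det] eq_matI)

section \<open>The dominant modes and the limit\<close>

text \<open>These are the orderings of the dominant frequency set; Cauchy--Binet was left
  uncollected, so each ordering is a separate mode.\<close>

definition top_modes :: "nat \<Rightarrow> nat \<Rightarrow> (nat \<Rightarrow> nat) set" where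
  "top_modes N n = {d \<in> modes N 0 n. d ` {0..<n} = {0..<n}}"

text \<open>Reordering the rows of the \<mu>-determinant yields the sign of the permutation, which
  turns the products of waves at \<eta> into the Leibniz sum of a second determinant.\<close>

lemma sum_top_modes:
  assumes "2 * (n - 1) < N"
  shows "(\<Sum>d\<in>top_modes N n. mode_coeff N 0 0 n \<eta> \<mu> d) =
    (\<Prod>i=0..<n. 2 / real N * real (fold_weight N 0 i)) *
    fdet n (\<lambda>i j. cos (real i * (2 * pi * \<eta> (Suc j) / real N))) *
    fdet n (\<lambda>i j. cos (real i * (2 * pi * \<mu> (Suc j) / real N)))"
proof -
  let ?I = "{0..<n}"
  let ?W = "\<lambda>i. 2 / real N * real (fold_weight N 0 i)"
  let ?f = "\<lambda>x i j. cos (real i * (2 * pi * x (Suc j) / real N))"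
  have f: "wave N 0 (real d) (x (Suc j)) = ?f x d j" for d j and x :: "nat \<Rightarrow> real"
    by (simp add: wave_def mult_ac)
  have "(\<Sum>d\<in>top_modes N n. mode_coeff N 0 0 n \<eta> \<mu> d) =
     (\<Sum>p | p permutes ?I. mode_coeff N 0 0 n \<eta> \<mu> (restrict p ?I))"
  \<comment> \<open>Modes are \<open>undefined\<close> outside \<open>{0..<n}\<close> while
    permutations are the identity there; the two witnesses translate.\<close>
  proof (rule sum.reindex_bij_witness[where i = "\<lambda>p. restrict p ?I" and j = "\<lambda>d i. if i \<in> ?I then d i else i"])
    fix d assume d: "d \<in> top_modes N n"
    hence "inj_on d ?I" unfolding top_modes_def by (intro eq_card_imp_inj_on) auto
    hence bij: "bij_betw d ?I ?I" using d by (auto simp: bij_betw_def top_modes_def)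
    show "(\<lambda>i. if i \<in> ?I then d i else i) \<in> {p. p permutes ?I}"
      using bij_imp_permutes[of "\<lambda>i. if i \<in> ?I then d i else i" ?I] bij bij_betw_cong[of ?I "\<lambda>i. if i \<in> ?I then d i else i" d ?I]
      by auto
    show "restrict (\<lambda>i. if i \<in> ?I then d i else i) ?I = d"
      using d by (auto simp: top_modes_def modes_def PiE_iff extensional_def)
    thus "mode_coeff N 0 0 n \<eta> \<mu> (restrict (\<lambda>i. if i \<in> ?I then d i else i) ?I) = mode_coeff N 0 0 n \<eta> \<mu> d"
      by simp
  next
    fix p assume "p \<in> {p. p permutes ?I}"
    hence p: "p permutes ?I" by simp
    show "(\<lambda>i. if i \<in> ?I then restrict p ?I i else i) = p"
      using p by (auto simp: permutes_def)
    have "2 * p i \<le> N" if "i < n" for i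
    proof -
      have "p i < n" using permutes_in_image[OF p, of i] that by simp
      thus ?thesis using assms by linarith
    qed
    moreover have "restrict p ?I ` ?I = ?I" using permutes_image[OF p] by simp
    ultimately show "restrict p ?I \<in> top_modes N n"
      unfolding top_modes_def modes_def by auto
  qed
  also have "\<dots> = (\<Sum>p | p permutes ?I. (\<Prod>i=0..<n. ?W i) * fdet n (?f \<mu>) * (signof p * (\<Prod>i=0..<n. ?f \<eta> (p i) i)))"
  proof (intro sum.cong refl)
    fix p assume "p \<in> {p. p permutes ?I}"
    hence p: "p permutes ?I" by simp
    have "(\<Prod>i=0..<n. ?W (p i)) = (\<Prod>i=0..<n. ?W i)"
      using prod.permute[OF p, of ?W] by (simp add: o_def)
    moreover have "fdet n (\<lambda>i j. ?f \<mu> (restrict p ?I i) j) = signof p * fdet n (?f \<mu>)"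
      using fdet_permute_rows[OF p, of "?f \<mu>"] by (subst fdet_cong[of n _ "\<lambda>i. ?f \<mu> (p i)"]) auto
    moreover have "mode_coeff N 0 0 n \<eta> \<mu> (restrict p ?I) = (\<Prod>i=0..<n. ?W (p i)) *
        (\<Prod>i=0..<n. ?f \<eta> (p i) i) * fdet n (\<lambda>i j. ?f \<mu> (restrict p ?I i) j)"
      unfolding mode_coeff_def f[symmetric]
      by (intro arg_cong2[of _ _ _ _ "(*)"] prod.cong refl) auto
    ultimately show "mode_coeff N 0 0 n \<eta> \<mu> (restrict p ?I) =
        (\<Prod>i=0..<n. ?W i) * fdet n (?f \<mu>) * (signof p * (\<Prod>i=0..<n. ?f \<eta> (p i) i))"
      by (simp only: mult_ac)
  qed
  also have "\<dots> = (\<Prod>i=0..<n. ?W i) * fdet n (?f \<mu>) * fdet n (\<lambda>i j. ?f \<eta> j i)"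
    unfolding fdet_Leibniz[of n "\<lambda>i j. ?f \<eta> j i"] sum_distrib_left ..
  also have "fdet n (\<lambda>i j. ?f \<eta> j i) = fdet n (?f \<eta>)" by (rule fdet_transpose)
  finally show ?thesis by (simp only: mult_ac)
qed

text \<open>The bound is asked only where \<open>C d\<close> is nonzero, since modes with repeated
  frequencies may have larger eigenvalues but have coefficient 0.\<close>

lemma dominant_power_sum_limit:
  fixes P C :: "'a \<Rightarrow> real"
  assumes "finite X" "T \<subseteq> X" "\<Lambda> > 0" "\<And>d. d \<in> T \<Longrightarrow> P d = \<Lambda>"
    and "\<And>d. d \<in> X - T \<Longrightarrow> C d \<noteq> 0 \<Longrightarrow> \<bar>P d\<bar> < \<Lambda>"
  shows "(\<lambda>k. (\<Sum>d\<in>X. P d ^ k * C d) / \<Lambda> ^ k) \<longlonglongrightarrow> sum C T"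
proof -
  have "(\<lambda>k. \<Sum>d\<in>X. (P d / \<Lambda>) ^ k * C d) \<longlonglongrightarrow> (\<Sum>d\<in>X. if d \<in> T then C d else 0)"
  proof (rule tendsto_sum)
    fix d assume d: "d \<in> X"
    consider "d \<in> T" | "d \<notin> T" "C d = 0" | "d \<notin> T" "C d \<noteq> 0" by blast
    thus "(\<lambda>k. (P d / \<Lambda>) ^ k * C d) \<longlonglongrightarrow> (if d \<in> T then C d else 0)"
    proof cases
      case 3
      hence "\<bar>P d / \<Lambda>\<bar> < 1" using assms(3,5) d by simp
      hence "(\<lambda>k. (P d / \<Lambda>) ^ k) \<longlonglongrightarrow> 0" by (intro LIMSEQ_power_zero) simp
      thus ?thesis using 3 tendsto_mult_left_zero by fastforce
    qed (use assms(3,4) in auto)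
  qed
  moreover have "(\<Sum>d\<in>X. if d \<in> T then C d else 0) = sum C T"
    using assms(1,2) by (simp add: sum.If_cases Int_absorb1)
  ultimately show ?thesis
    by (simp add: sum_divide_distrib power_divide)
qed

lemma prod_pairs:
  fixes G :: "nat \<Rightarrow> nat \<Rightarrow> real"
  shows "(\<Prod>(h, t)\<in>{(h, t). 1 \<le> h \<and> h < t \<and> t \<le> n}. G h t) = (\<Prod>j<n. \<Prod>h<j. G (Suc h) (Suc j))"
proof -
  have "(\<Prod>j<n. \<Prod>h<j. G (Suc h) (Suc j)) = (\<Prod>(j, h)\<in>Sigma {..<n} (\<lambda>j. {..<j}). G (Suc h) (Suc j))"
    by (rule prod.Sigma) auto
  also have "\<dots> = (\<Prod>(h, t)\<in>{(h, t). 1 \<le> h \<and> h < t \<and> t \<le> n}. G h t)"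
    by (rule prod.reindex_bij_witness[where i = "\<lambda>(h, t). (t - 1, h - 1)" and j = "\<lambda>(j, h). (Suc h, Suc j)"])
       auto
  finally show ?thesis ..
qed

text \<open>The squares are the leading coefficients from two determinants, and \<open>4 ^ j\<close>
  is a factor 4 for each pair \<open>h < j\<close>. For \<open>j > 0\<close> the factor is
  \<open>4 ^ (2 * j - 1)\<close>, and the first \<open>l\<close> odd numbers add up to
  \<open>l ^ 2\<close>.\<close>

lemma chebyshev_constant:
  "(\<Prod>j<Suc l. (if j = 0 then 1 else 2 ^ (j - 1)) ^ 2 * 4 ^ j) = (4 :: real) ^ (l ^ 2)"
proof (induction l)
  case (Suc l)
  have "((2::real) ^ l) ^ 2 = 4 ^ l" by (simp add: power2_eq_square flip: power_mult_distrib)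
  moreover have "Suc l ^ 2 = l ^ 2 + l + Suc l" by (simp add: power2_eq_square)
  ultimately show ?case using Suc by (simp add: prod.lessThan_Suc[of _ "Suc l"] power_add del: prod.lessThan_Suc)
qed simp

text \<open>Both determinants are Vandermonde products of cosine differences, hence of sines of
  roots. The rest is bookkeeping of constants; the division by 4 is the average over the four
  symmetries.\<close>

lemma leading_coefficient:
  assumes "n > 0" "m > 0" "2 * m = real N" "2 * (n - 1) < N"
  shows "(\<Prod>i=0..<n. 2 / real N * real (fold_weight N 0 i)) *
      fdet n (\<lambda>i j. cos (real i * (2 * pi * \<eta> (Suc j) / real N))) *
      fdet n (\<lambda>i j. cos (real i * (2 * pi * \<mu> (Suc j) / real N))) / 4 =
    4 ^ (n ^ 2) / (2 * (8 * m) ^ n) *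
      (\<Prod>(h, t) \<in> {(h, t). 1 \<le> h \<and> h < t \<and> t \<le> n}.
            sin (pi * (\<eta> h - \<eta> t) / (2 * m)) * sin (pi * (\<mu> h - \<mu> t) / (2 * m))
          * sin (pi * (\<eta> h + \<eta> t) / (2 * m)) * sin (pi * (\<mu> h + \<mu> t) / (2 * m)))"
proof -
  define G where "G h t = sin (pi * (\<eta> h - \<eta> t) / (2 * m)) * sin (pi * (\<mu> h - \<mu> t) / (2 * m))
          * sin (pi * (\<eta> h + \<eta> t) / (2 * m)) * sin (pi * (\<mu> h + \<mu> t) / (2 * m))" for h t
  obtain l where l: "n = Suc l" using assms(1) by (cases n) auto
  let ?c = "\<lambda>i. if i = 0 then 1 else 2 ^ (i - 1) :: real"
  have N: "2 * pi * x / real N = pi * x / m" for x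
    unfolding assms(3)[symmetric] by simp
  have V: "fdet n (\<lambda>i j. cos (real i * (2 * pi * x (Suc j) / real N))) =
      (\<Prod>i<n. ?c i) * (\<Prod>j<n. \<Prod>h<j. 2 * sin (pi * (x (Suc h) + x (Suc j)) / (2 * m)) * sin (pi * (x (Suc h) - x (Suc j)) / (2 * m)))"
    for x :: "nat \<Rightarrow> real"
    unfolding N fdet_cos_multiples cos_diff_eq_sin_mult_sin[OF assms(2)] ..
  have "fdet n (\<lambda>i j. cos (real i * (2 * pi * \<eta> (Suc j) / real N))) *
      fdet n (\<lambda>i j. cos (real i * (2 * pi * \<mu> (Suc j) / real N))) =
      (\<Prod>j<n. ?c j ^ 2 * (\<Prod>h<j. 4 * G (Suc h) (Suc j)))"
  proof -
    have G4: "4 * G h t = (2 * sin (pi * (\<eta> h + \<eta> t) / (2 * m)) * sin (pi * (\<eta> h - \<eta> t) / (2 * m))) *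
        (2 * sin (pi * (\<mu> h + \<mu> t) / (2 * m)) * sin (pi * (\<mu> h - \<mu> t) / (2 * m)))" for h t
      by (simp add: G_def)
    show ?thesis unfolding V G4 by (simp only: prod.distrib power2_eq_square mult_ac)
  qed
  also have "\<dots> = (\<Prod>j<n. ?c j ^ 2 * 4 ^ j) * (\<Prod>j<n. \<Prod>h<j. G (Suc h) (Suc j))"
    by (simp only: prod.distrib prod_constant card_lessThan mult_ac)
  also have "(\<Prod>j<n. ?c j ^ 2 * 4 ^ j) = 4 ^ (l ^ 2)"
    unfolding l by (rule chebyshev_constant)
  finally have VV: "fdet n (\<lambda>i j. cos (real i * (2 * pi * \<eta> (Suc j) / real N))) *
      fdet n (\<lambda>i j. cos (real i * (2 * pi * \<mu> (Suc j) / real N))) =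
      4 ^ (l ^ 2) * (\<Prod>j<n. \<Prod>h<j. G (Suc h) (Suc j))" .
  have "(\<Prod>i=0..<n. 2 / real N * real (fold_weight N 0 i)) = (\<Prod>i<Suc l. if i = 0 then 1 / m else 2 / m)"
    unfolding lessThan_atLeast0 l[symmetric]
  proof (intro prod.cong refl)
    fix i assume "i \<in> {0..<n}"
    hence "2 * i < N" using assms(4) by auto
    thus "2 / real N * real (fold_weight N 0 i) = (if i = 0 then 1 / m else 2 / m)"
      using fold_weight_0[of i N] unfolding assms(3)[symmetric] by simp
  qed
  also have "\<dots> = 1 / m * (2 / m) ^ l"
    by (subst prod.lessThan_Suc_shift) simp
  finally have W: "(\<Prod>i=0..<n. 2 / real N * real (fold_weight N 0 i)) = 1 / m * (2 / m) ^ l" .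
  have const: "1 / m * (2 / m) ^ l * 4 ^ (l ^ 2) / 4 = 4 ^ (n ^ 2) / (2 * (8 * m) ^ n)"
  proof -
    have "n ^ 2 = l ^ 2 + l + l + 1" by (simp add: l power2_eq_square)
    hence "(4::real) ^ (n ^ 2) = 4 ^ (l ^ 2) * 4 ^ l * 4 ^ l * 4" by (simp add: power_add)
    moreover have "(8 * m) ^ n = 2 ^ l * 4 ^ l * 8 * m * m ^ l"
    proof -
      have "(8::real) ^ l = 2 ^ l * 4 ^ l" by (simp flip: power_mult_distrib)
      thus ?thesis by (simp add: l power_mult_distrib)
    qed
    moreover have "(2::real) ^ l * 2 ^ l = 4 ^ l" by (simp flip: power_mult_distrib)
    ultimately show ?thesis using assms(2) by (simp add: power_divide field_simps)
  qed
  have "w * v * v' / 4 = 4 ^ (n ^ 2) / (2 * (8 * m) ^ n) * g"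
    if "v * v' = 4 ^ (l ^ 2) * g" "w = 1 / m * (2 / m) ^ l" for w v v' g
  proof -
    have "w * v * v' / 4 = w * (v * v') / 4" by (simp only: mult.assoc)
    also have "\<dots> = (1 / m * (2 / m) ^ l * 4 ^ (l ^ 2) / 4) * g"
      unfolding that by (simp only: times_divide_eq_left times_divide_eq_right mult.assoc)
    finally show ?thesis unfolding const .
  qed
  from this[OF VV W] show ?thesis
    unfolding G_def[symmetric] prod_pairs .
qed

text \<open>Only the determinant that is even at both ends contains dominant modes; the other three
  vanish in the limit.\<close>

lemma refl_det_asymptotics:
  assumes "n > 0" "N > 0" "2 * (n - 1) < N"
  shows "(\<lambda>k. (\<Sum>s\<in>{0, 1}. \<Sum>\<tau>\<in>{0, pi/2}. \<Sum>d\<in>modes N s n. mode_eigen N s n d ^ k * mode_coeff N s \<tau> n \<eta> \<mu> d) / 4 /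
      (\<Prod>j<n. 2 * cos (pi * real j / real N)) ^ k)
    \<longlonglongrightarrow> (\<Sum>d\<in>top_modes N n. mode_coeff N 0 0 n \<eta> \<mu> d) / 4"
proof -
  define \<Lambda> where "\<Lambda> = (\<Prod>j<n. 2 * cos (pi * real j / real N))"
  define A where "A s \<tau> k = (\<Sum>d\<in>modes N s n. mode_eigen N s n d ^ k * mode_coeff N s \<tau> n \<eta> \<mu> d)" for s \<tau> k
  have pos: "\<Lambda> > 0"
    unfolding \<Lambda>_def
  proof (rule prod_pos)
    fix j assume "j \<in> {..<n}"
    hence "2 * j < N" using assms(3) by auto
    hence "pi * (real j / real N) < pi * (1 / 2)" using assms(2) by (intro mult_strict_left_mono) (auto simp: field_simps)
    moreover have "0 \<le> pi * (real j / real N)" by simp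
    ultimately have "0 < cos (pi * (real j / real N))"
      using pi_gt_zero by (intro cos_gt_zero_pi) linarith+
    thus "0 < 2 * cos (pi * real j / real N)" by simp
  qed
  have lim0: "(\<lambda>k. A s \<tau> k / \<Lambda> ^ k) \<longlonglongrightarrow> 0"
    if "s \<le> 1" "\<tau> \<in> {0, pi/2}" "(s, \<tau>) \<noteq> (0, 0)" for s \<tau>
  proof -
    \<comment> \<open>The dominant set is empty: every mode with nonzero coefficient has a strictly
      smaller eigenvalue.\<close>
    have "(\<lambda>k. A s \<tau> k / \<Lambda> ^ k) \<longlonglongrightarrow> sum (mode_coeff N s \<tau> n \<eta> \<mu>) {}"
      unfolding A_def
    proof (rule dominant_power_sum_limit[OF finite_modes _ pos])
      fix d assume d: "d \<in> modes N s n - {}" and nz: "mode_coeff N s \<tau> n \<eta> \<mu> d \<noteq> 0"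
      hence "d \<in> modes N s n" by simp
      from mode_eigen_bounds(1,4)[OF assms(1,2) that(1) this nz] assms(3) that(2,3)
      show "\<bar>mode_eigen N s n d\<bar> < \<Lambda>" by (simp add: \<Lambda>_def)
    qed auto
    thus ?thesis by simp
  qed
  have limtop: "(\<lambda>k. A 0 0 k / \<Lambda> ^ k) \<longlonglongrightarrow> sum (mode_coeff N 0 0 n \<eta> \<mu>) (top_modes N n)"
    unfolding A_def
  proof (rule dominant_power_sum_limit[OF finite_modes _ pos])
    show "top_modes N n \<subseteq> modes N 0 n" by (auto simp: top_modes_def)
    fix d assume "d \<in> top_modes N n"
    hence im: "d ` {0..<n} = {0..<n}" by (simp add: top_modes_def)
    hence "inj_on d {0..<n}" by (intro eq_card_imp_inj_on) auto
    from prod.reindex[OF this, of "\<lambda>j. 2 * cos (pi * real j / real N)"]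
    show "mode_eigen N 0 n d = \<Lambda>" unfolding mode_eigen_def \<Lambda>_def im by (simp add: lessThan_atLeast0)
  next
    fix d assume d: "d \<in> modes N 0 n - top_modes N n" and nz: "mode_coeff N 0 0 n \<eta> \<mu> d \<noteq> 0"
    hence "d \<in> modes N 0 n" "d ` {0..<n} \<noteq> {0..<n}" by (auto simp: top_modes_def)
    from mode_eigen_bounds(1,5)[OF assms(1,2) _ this(1) nz] assms(3) this(2)
    show "\<bar>mode_eigen N 0 n d\<bar> < \<Lambda>" by (simp add: \<Lambda>_def)
  qed
  have "(\<lambda>k. (A 0 0 k / \<Lambda> ^ k + A 0 (pi/2) k / \<Lambda> ^ k + A 1 0 k / \<Lambda> ^ k + A 1 (pi/2) k / \<Lambda> ^ k) / 4)
    \<longlonglongrightarrow> (sum (mode_coeff N 0 0 n \<eta> \<mu>) (top_modes N n) + 0 + 0 + 0) / 4"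
    by (intro tendsto_intros limtop lim0) auto
  moreover have "(\<lambda>k. (A 0 0 k / \<Lambda> ^ k + A 0 (pi/2) k / \<Lambda> ^ k + A 1 0 k / \<Lambda> ^ k + A 1 (pi/2) k / \<Lambda> ^ k) / 4) =
      (\<lambda>k. (\<Sum>s\<in>{0, 1}. \<Sum>\<tau>\<in>{0, pi/2}. A s \<tau> k) / 4 / \<Lambda> ^ k)"
    by (simp add: add_divide_distrib add.assoc mult.commute)
  ultimately show ?thesis unfolding A_def[symmetric] \<Lambda>_def[symmetric] by (simp only: add_0_right)
qed

text \<open>The empty walk is counted by \<open>refl_det\<close>, so some \<open>n\<close> distinct frequencies exist.\<close>
lemma alcove_D_size:
  assumes "n \<ge> 2" "N > 0" "2 * m = real N" "\<eta> \<in> alcove_D n m" "in_coset n c \<eta>"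
  shows "2 * (n - 1) \<le> N"
proof -
  have "refl_det N 0 n \<eta> \<eta> \<noteq> 0" using refl_det_0[OF assms(1-4,4,5,5)] by simp
  moreover have "refl_det N 0 n \<eta> \<eta> = 0"
    if "\<And>s \<tau> d. s \<le> 1 \<Longrightarrow> d \<in> modes N s n \<Longrightarrow> mode_coeff N s \<tau> n \<eta> \<eta> d = 0"
    unfolding refl_det_modes[OF assms(2) even_zero assms(5,5)] by (simp add: that)
  ultimately obtain s \<tau> d where *: "s \<le> 1" "d \<in> modes N s n" "mode_coeff N s \<tau> n \<eta> \<eta> d \<noteq> 0" by blast
  show ?thesis by (rule mode_eigen_bounds(3)[OF _ assms(2) *]) (use assms(1) in simp)
qed

section \<open>Integrality, parity and the asymptotic statement\<close>

lemma half_integer_minus_half: "half_integer x \<Longrightarrow> x - 1 / 2 \<in> \<int>"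
proof -
  assume "half_integer x"
  then obtain a where a: "odd a" "x = of_int a / 2" unfolding half_integer_def by blast
  from a(1) obtain b where "a = 2 * b + 1" by (rule oddE)
  hence "x - 1 / 2 = of_int b" using a(2) by (simp add: field_simps)
  thus "x - 1 / 2 \<in> \<int>" by simp
qed

lemma two_times_half_integer:
  assumes "m > 0" "m \<in> \<int> \<or> half_integer m"
  shows "\<exists>N::nat. 2 * m = real N \<and> N > 0"
proof -
  have "\<exists>i::int. 2 * m = of_int i"
    using assms(2)
  proof
    assume "m \<in> \<int>"
    then obtain i where "m = of_int i" by (rule Ints_cases)
    hence "2 * m = of_int (2 * i)" by simp
    thus ?thesis ..
  next
    assume "half_integer m"
    then obtain a where "m = of_int a / 2" unfolding half_integer_def by blast
    hence "2 * m = of_int a" by simp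
    thus ?thesis ..
  qed
  then obtain i where i: "2 * m = of_int i" ..
  hence "0 < i" using assms(1) by linarith
  hence "2 * m = real (nat i)" "0 < nat i" using i by simp_all
  thus ?thesis by blast
qed

lemma in_coset_exists:
  assumes "(\<forall>j\<in>{1..n}. \<eta> j \<in> \<int> \<and> \<mu> j \<in> \<int>) \<or>
    (\<forall>j\<in>{1..n}. half_integer (\<eta> j) \<and> half_integer (\<mu> j))"
  shows "\<exists>c. in_coset n c \<eta> \<and> in_coset n c \<mu>"
  using assms
proof
  assume "\<forall>j\<in>{1..n}. \<eta> j \<in> \<int> \<and> \<mu> j \<in> \<int>"
  hence "in_coset n 0 \<eta> \<and> in_coset n 0 \<mu>" by (simp add: in_coset_def)
  thus ?thesis ..
next
  assume "\<forall>j\<in>{1..n}. half_integer (\<eta> j) \<and> half_integer (\<mu> j)"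
  hence "in_coset n 1 \<eta> \<and> in_coset n 1 \<mu>"
    unfolding in_coset_def using half_integer_minus_half by auto
  thus ?thesis ..
qed

text \<open>Both points lie in one coset, so \<open>\<eta> j + \<mu> j\<close> is an integer and its
  double is even.\<close>

lemma even_of_rcong:
  assumes "in_coset n c \<eta>" "in_coset n c \<mu>" "j \<in> {1..n}" "[real k = 2 * \<eta> j + 2 * \<mu> j] (rmod 2)"
  shows "even k"
proof -
  obtain r where r: "2 * \<eta> j + 2 * \<mu> j = real k + of_int r * 2"
    using assms(4) unfolding rcong_altdef by blast
  have "\<eta> j + \<mu> j \<in> \<int>" by (rule in_coset_add[OF assms(1,2,3,3)])
  then obtain a where "\<eta> j + \<mu> j = of_int a" by (rule Ints_cases)
  hence "real_of_int (int k) = of_int (2 * (a - r))" using r by simp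
  hence "int k = 2 * (a - r)" by (simp only: of_int_eq_iff)
  thus ?thesis by presburger
qed

lemma in_coset_shift_even:
  assumes "in_coset n c x" "even k"
  shows "in_coset n (c + int k) x"
  unfolding in_coset_def
proof
  fix j assume "j \<in> {1..n}"
  hence "x j - of_int c / 2 \<in> \<int>" using assms(1) by (simp add: in_coset_def)
  moreover obtain b where "k = 2 * b" using assms(2) by (rule evenE)
  ultimately have "x j - of_int (c + int k) / 2 = (x j - of_int c / 2) - real b" "x j - of_int c / 2 \<in> \<int>"
    by (simp_all add: field_simps)
  thus "x j - of_int (c + int k) / 2 \<in> \<int>" by (metis Ints_diff Ints_of_nat)
qed

text \<open>The limit of \<open>S\<close> holds along all \<open>k\<close> and is restricted to
  \<open>K\<close>, where \<open>S\<close> agrees with the count \<open>f\<close>.\<close>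

lemma asymp_equiv_geometric:
  fixes f S :: "nat \<Rightarrow> real"
  assumes "(\<lambda>k. S k / L ^ k) \<longlonglongrightarrow> q * P" "q * P \<noteq> 0" "\<And>k. k \<in> K \<Longrightarrow> f k = S k"
  shows "f \<sim>[inf sequentially (principal K)] (\<lambda>k. q * L ^ k * P)"
proof (rule asymp_equivI')
  have "(\<lambda>k. S k / L ^ k / (q * P)) \<longlonglongrightarrow> q * P / (q * P)"
    using assms(1,2) by (intro tendsto_divide tendsto_const)
  hence "((\<lambda>k. S k / (q * L ^ k * P)) \<longlongrightarrow> 1) sequentially"
    using assms(2) by (simp add: mult_ac)
  hence "((\<lambda>k. S k / (q * L ^ k * P)) \<longlongrightarrow> 1) (inf sequentially (principal K))"
    by (rule tendsto_mono[OF inf_le1])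
  moreover have "\<forall>\<^sub>F k in inf sequentially (principal K). S k / (q * L ^ k * P) = f k / (q * L ^ k * P)"
    unfolding eventually_inf_principal using assms(3) by simp
  ultimately show "((\<lambda>k. f k / (q * L ^ k * P)) \<longlongrightarrow> 1) (inf sequentially (principal K))"
    by (rule Lim_transform_eventually)
qed

theorem theorem31:
  fixes n :: nat and m :: real and \<eta> \<mu> :: "nat \<Rightarrow> real"
  assumes "n \<ge> 2"
    and "m > 0" and "m \<in> \<int> \<or> half_integer m"
    and "\<eta> \<in> alcove_D n m" and "\<mu> \<in> alcove_D n m"
    and "(\<forall>j\<in>{1..n}. \<eta> j \<in> \<int> \<and> \<mu> j \<in> \<int>) \<or>
         (\<forall>j\<in>{1..n}. half_integer (\<eta> j) \<and> half_integer (\<mu> j))"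
  shows "(\<lambda>k. real (card (diagonal_walks n (alcove_D n m) k \<eta> \<mu>)))
    \<sim>[inf sequentially (principal {k. \<forall>j\<in>{1..n}. [real k = 2 * \<eta> j + 2 * \<mu> j] (rmod 2)})]
    (\<lambda>k. 4 ^ (n ^ 2) / (2 * (8 * m) ^ n)
       * (2 ^ n * (\<Prod>j = 0..n - 1. cos (real j * pi / (2 * m)))) ^ k
       * (\<Prod>(h, t) \<in> {(h, t). 1 \<le> h \<and> h < t \<and> t \<le> n}.
            sin (pi * (\<eta> h - \<eta> t) / (2 * m)) * sin (pi * (\<mu> h - \<mu> t) / (2 * m))
          * sin (pi * (\<eta> h + \<eta> t) / (2 * m)) * sin (pi * (\<mu> h + \<mu> t) / (2 * m))))"
    (is "?f \<sim>[inf sequentially (principal ?K)] (\<lambda>k. ?q * ?\<Lambda> ^ k * ?P)")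
proof -
  obtain N where N: "2 * m = real N" "N > 0" using two_times_half_integer[OF assms(2,3)] by blast
  have n: "n > 0" using assms(1) by simp
  obtain c where c: "in_coset n c \<eta>" "in_coset n c \<mu>" using in_coset_exists[OF assms(6)] by blast
  have even: "even k" if "k \<in> ?K" for k
    using even_of_rcong[OF c, of 1 k] that assms(1) by auto
  define S where "S k = (\<Sum>s\<in>{0, 1}. \<Sum>\<tau>\<in>{0, pi/2}. \<Sum>d\<in>modes N s n.
      mode_eigen N s n d ^ k * mode_coeff N s \<tau> n \<eta> \<mu> d) / 4" for k
  have count: "?f k = S k" if "k \<in> ?K" for k
  proof -
    note in_coset_shift_even[OF c(2) even[OF that]]
    thus ?thesis
      unfolding S_def using card_diagonal_walks_eq_refl_det[OF assms(1) N(2,1) assms(4,5) c(1)]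
        refl_det_modes[OF N(2) even[OF that] c] by simp
  qed
  have \<Lambda>: "?\<Lambda> = (\<Prod>j<n. 2 * cos (pi * real j / real N))"
  proof -
    have "{0..n - 1} = {..<n}" using n by auto
    thus ?thesis unfolding N(1) by (simp add: prod.distrib mult.commute)
  qed
  note size = alcove_D_size[OF assms(1) N(2,1) assms(4) c(1)]
  show ?thesis
  proof (cases "2 * (n - 1) = N")
    case True
    \<comment> \<open>The smallest possible alcove: both sides are \<open>0\<close> for \<open>k > 0\<close>.\<close>
    have zero: "?\<Lambda> = 0"
    proof -
      have rN: "real N = 2 * real (n - 1)" unfolding True[symmetric] by simp
      moreover have "pi * x / (2 * x) = pi / 2" if "x > 0" for x :: real using that by simp
      moreover have "0 < real (n - 1)" using rN N(2) by linarith
      ultimately have "pi * real (n - 1) / real N = pi / 2" by metis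
      hence "2 * cos (pi * real (n - 1) / real N) = 0" by (simp only: cos_pi_half mult_zero_right)
      moreover have "n - 1 \<in> {..<n}" using n by simp
      ultimately show ?thesis unfolding \<Lambda> by (intro prod_zero finite_lessThan bexI)
    qed
    have "S k = 0" if "k > 0" for k
    proof -
      \<comment> \<open>If the coefficient is nonzero, the eigenvalue is squeezed between 0 and the
        vanishing product. Positivity of \<open>k\<close> excludes \<open>0 ^ 0 = 1\<close>.\<close>
      have "mode_eigen N s n d ^ k * mode_coeff N s \<tau> n \<eta> \<mu> d = 0"
        if "s \<le> 1" "d \<in> modes N s n" for s \<tau> d
      proof (cases "mode_coeff N s \<tau> n \<eta> \<mu> d = 0")
        case False
        from mode_eigen_bounds(1,2)[OF n N(2) that this]
        have "mode_eigen N s n d = 0" unfolding \<Lambda>[symmetric] zero by simp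
        thus ?thesis using \<open>k > 0\<close> by simp
      qed simp
      hence "(\<Sum>d\<in>modes N s n. mode_eigen N s n d ^ k * mode_coeff N s \<tau> n \<eta> \<mu> d) = 0"
        if "s \<le> 1" for s \<tau>
        using that by (intro sum.neutral ballI)
      thus ?thesis unfolding S_def by simp
    qed
    \<comment> \<open>Eventual equality suffices, as asymptotic equivalence counts 0/0 as 1.\<close>
    hence "?f k = ?q * ?\<Lambda> ^ k * ?P" if "k > 0" "k \<in> ?K" for k
      unfolding zero count[OF that(2)] using that(1) by simp
    hence "\<forall>\<^sub>F k in inf sequentially (principal ?K). ?f k = ?q * ?\<Lambda> ^ k * ?P"
      unfolding eventually_inf_principal
      by (intro eventually_mono[OF eventually_gt_at_top[of 0]] impI)
    thus ?thesis by (rule asymp_equiv_refl_ev)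
  next
    case False
    hence N': "2 * (n - 1) < N" using size by simp
    have pos: "0 < ?q" using assms(2) by simp
    \<comment> \<open>All roots take values strictly between 0 and \<open>2 * m\<close> on the
      alcove, so every sine is positive and the limit can serve as a divisor.\<close>
    moreover have "0 < ?P"
    proof (rule prod_pos, clarify)
      fix h t assume "1 \<le> h" "h < t" "t \<le> n"
      hence "0 < x h - x t \<and> x h - x t < 2 * m \<and> 0 < x h + x t \<and> x h + x t < 2 * m"
        if "x \<in> alcove_D n m" for x
        using that unfolding alcove_D_iff[OF assms(1)] by blast
      thus "0 < sin (pi * (\<eta> h - \<eta> t) / (2 * m)) * sin (pi * (\<mu> h - \<mu> t) / (2 * m))
          * sin (pi * (\<eta> h + \<eta> t) / (2 * m)) * sin (pi * (\<mu> h + \<mu> t) / (2 * m))"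
        using assms(4,5) by (intro mult_pos_pos sin_pi_times_pos[OF assms(2)]) auto
    qed
    ultimately have "0 < ?q * ?P" by (rule mult_pos_pos)
    hence C: "?q * ?P \<noteq> 0" by (rule less_imp_neq[THEN not_sym])
    have "(\<lambda>k. S k / ?\<Lambda> ^ k) \<longlonglongrightarrow> ?q * ?P"
      using refl_det_asymptotics[OF n N(2) N', of \<eta> \<mu>]
      unfolding S_def \<Lambda> sum_top_modes[OF N'] leading_coefficient[OF n assms(2) N(1) N'] .
    thus ?thesis using C count by (rule asymp_equiv_geometric)
  qed
qed

end
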